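(* The following three statements are equivalent. (A) For all bipartite graphs $H_1, H_2$ and all vertices $u \in V(H_1)$, $v \in V(H_2)$, \[ \mathrm{ex}(n, H_1^u \odot H_2^v) = \Theta\bigl(\mathrm{ex}(n,H_1)+\mathrm{ex}(n,H_2)\bigr). \] (B) For every bipartite graph $H$, if $H_1, H_2$ are two (vertex-disjoint) copies of $H$ and $u \in V(H_1)$, $v \in V(H_2)$ are arbitrary vertices, then \[ \mathrm{ex}(n, H_1^u \odot H_2^v) = \Theta\bigl(\mathrm{ex}(n,H)\bigr). \] (C) For every bipartite graph $H$ with bipartition $(L,R)$, \[ z(n,n,H[L,R]) = \Theta\bigl(\mathrm{ex}(n,n,H)\bigr). \]
   Context: All graphs are finite and simple. $\mathrm{ex}(n,H)$ is the maximum number of edges in an $n$-vertex graph containing no subgraph isomorphic to $H$. $\mathrm{ex}(n,m,H)$ is the maximum number of edges of a subgraph of the complete bipartite graph $K_{n,m}$ containing no copy of $H$. For a bipartite graph $H$ with a given bipartition $(L,R)$, the Zarankiewicz number $z(n,m,H[L,R])$ is the maximum number of edges of a subgraph of $K_{n,m}$ that contains no copy of $H$ in which $L$ is embedded in the part of size $n$ and $R$ in the part of size $m$. For graphs $H_1,H_2$ with disjoint vertex sets and vertices $u\in V(H_1)$, $v\in V(H_2)$, $H_1^u\odot H_2^v$ denotes the graph obtained from the disjoint union of $H_1$ and $H_2$ by identifying $u$ and $v$. The asymptotic notation $\Theta$ refers to $n\to\infty$, with implied constants allowed to depend on the fixed graphs involved.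
   Formalization: In (A) pairs where H_1 and H_2 both have exactly one edge are excluded, and in (B) graphs H with exactly one edge: there the glued graph has linear extremal number while the right side is eventually 0. Subgraphs of K_{n,m} keep all n+m vertices. *)

theory Defs
  imports Complex_Main "HOL-Library.Landau_Symbols"
begin

datatype 'a graph = Graph (verts: "'a set") (edges: "'a set set")

definition simple_graph :: "'a graph \<Rightarrow> bool" where
  "simple_graph G \<longleftrightarrow> finite (verts G) \<and> (\<forall>e\<in>edges G. e \<subseteq> verts G \<and> card e = 2)"

definition bipartition :: "'a graph \<Rightarrow> 'a set \<Rightarrow> 'a set \<Rightarrow> bool" where
  "bipartition G L R \<longleftrightarrow> L \<inter> R = {} \<and> L \<union> R = verts G \<and>
     (\<forall>e\<in>edges G. \<exists>x\<in>L. \<exists>y\<in>R. e = {x, y})"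

definition bipartite :: "'a graph \<Rightarrow> bool" where
  "bipartite G \<longleftrightarrow> simple_graph G \<and> (\<exists>L R. bipartition G L R)"

definition subgraph :: "'a graph \<Rightarrow> 'a graph \<Rightarrow> bool" where
  "subgraph K G \<longleftrightarrow> simple_graph K \<and> verts K \<subseteq> verts G \<and> edges K \<subseteq> edges G"

definition spanning_subgraph :: "'a graph \<Rightarrow> 'a graph \<Rightarrow> bool" where
  "spanning_subgraph K G \<longleftrightarrow> subgraph K G \<and> verts K = verts G"

definition graph_iso :: "('a \<Rightarrow> 'b) \<Rightarrow> 'a graph \<Rightarrow> 'b graph \<Rightarrow> bool" where
  "graph_iso f H K \<longleftrightarrow> bij_betw f (verts H) (verts K) \<and> edges K = (`) f ` edges H"

definition contains_copy :: "'b graph \<Rightarrow> 'a graph \<Rightarrow> bool" where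
  "contains_copy G H \<longleftrightarrow> (\<exists>K f. subgraph K G \<and> graph_iso f H K)"

definition contains_copy_sided ::
  "'b graph \<Rightarrow> 'b set \<Rightarrow> 'b set \<Rightarrow> 'a graph \<Rightarrow> 'a set \<Rightarrow> 'a set \<Rightarrow> bool" where
  "contains_copy_sided G A B H L R \<longleftrightarrow>
     (\<exists>K f. subgraph K G \<and> graph_iso f H K \<and> f ` L \<subseteq> A \<and> f ` R \<subseteq> B)"

text \<open>The extremal numbers below are maxima of finite sets of naturals. Such a set can be empty
  (only for an edgeless \<open>H\<close>); the supremum on \<^typ>\<open>nat\<close> then gives the value \<open>0\<close>.\<close>

definition ex :: "nat \<Rightarrow> 'a graph \<Rightarrow> nat" where
  "ex n H = Sup {card (edges G) | G :: nat graph.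
     simple_graph G \<and> card (verts G) = n \<and> \<not> contains_copy G H}"

definition left_part :: "nat \<Rightarrow> (nat + nat) set" where
  "left_part n = Inl ` {..<n}"

definition right_part :: "nat \<Rightarrow> (nat + nat) set" where
  "right_part m = Inr ` {..<m}"

definition complete_bipartite :: "nat \<Rightarrow> nat \<Rightarrow> (nat + nat) graph" where
  "complete_bipartite n m =
     Graph (left_part n \<union> right_part m) {{x, y} | x y. x \<in> left_part n \<and> y \<in> right_part m}"

text \<open>Subgraphs of the complete bipartite graph are taken with its full vertex set. If vertices
  could be dropped, a pattern \<open>H\<close> with isolated vertices could be avoided merely by lack of room
  on one side.\<close>

definition ex_bip :: "nat \<Rightarrow> nat \<Rightarrow> 'a graph \<Rightarrow> nat" where
  "ex_bip n m H = Sup {card (edges G) | G.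
     spanning_subgraph G (complete_bipartite n m) \<and> \<not> contains_copy G H}"

definition zarankiewicz :: "nat \<Rightarrow> nat \<Rightarrow> 'a graph \<Rightarrow> 'a set \<Rightarrow> 'a set \<Rightarrow> nat" where
  "zarankiewicz n m H L R = Sup {card (edges G) | G.
     spanning_subgraph G (complete_bipartite n m) \<and>
     \<not> contains_copy_sided G (left_part n) (right_part m) H L R}"

text \<open>The type \<^typ>\<open>'a + 'b\<close> makes the two graphs disjoint; \<open>Inr v\<close> is then renamed to \<open>Inl u\<close>.\<close>

definition identify :: "'a \<Rightarrow> 'b \<Rightarrow> 'a + 'b \<Rightarrow> 'a + 'b" where
  "identify u v x = (if x = Inr v then Inl u else x)"

definition glue :: "'a graph \<Rightarrow> 'a \<Rightarrow> 'b graph \<Rightarrow> 'b \<Rightarrow> ('a + 'b) graph" where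
  "glue H1 u H2 v = Graph
     (identify u v ` (Inl ` verts H1 \<union> Inr ` verts H2))
     ((`) (identify u v) ` ((`) Inl ` edges H1 \<union> (`) Inr ` edges H2))"

text \<open>If \<open>H1\<close> and \<open>H2\<close> both have exactly one edge, then \<open>ex n H1 + ex n H2 = 0\<close> for large \<open>n\<close>,
  while \<open>ex n (glue H1 u H2 v)\<close> is at least the greatest integer not exceeding \<open>n / 2\<close> for all
  large \<open>n\<close> (stars contain no two disjoint edges, matchings no two adjacent ones). A statement comparing these
  orders of magnitude therefore has to exclude exactly this pair of graphs.\<close>

end

theory Submission imports Defs
begin

text \<open>(B) implies (C): up to a linear error, Zarankiewicz numbers are additive over disjoint unions,
  so \<open>H\<close> may be taken connected. Gluing two copies of \<open>H\<close> at a vertex of \<open>L\<close> and a vertex of \<open>R\<close>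
  yields a graph each of whose copies in \<open>K\<^sub>n\<^sub>,\<^sub>n\<close> contains a copy of \<open>H\<close> with \<open>L\<close> on the left, so
  \<open>z(n,n,H[L,R])\<close> is at most the extremal number of the glued graph at \<open>2n\<close>.

  (C) implies (A): name the sides so that \<open>u \<in> L1\<close> and \<open>v \<in> L2\<close>. In a bipartite graph without the
  glued graph, each left vertex either is not the root of a sided copy of \<open>H2\<close>, or has a bounded set
  of vertices that meets every sided copy of \<open>H1\<close> rooted there; a random vertex sample avoiding
  these sets reduces the second case to the Zarankiewicz number of \<open>H1\<close>. The linear error terms are
  absorbed because a graph with at least two edges has at least linear extremal number.\<close>

subsection \<open>Finite sets and averaging\<close>

lemma nat_Sup_le:
  fixes S :: "nat set"
  assumes "\<And>x. x \<in> S \<Longrightarrow> x \<le> M"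
  shows "Sup S \<le> M"
proof (cases "S = {}")
  case False
  then show ?thesis using assms by (intro cSup_least) auto
qed simp

lemma le_nat_Sup:
  fixes S :: "nat set"
  assumes "x \<in> S" "\<And>y. y \<in> S \<Longrightarrow> y \<le> M"
  shows "x \<le> Sup S"
  using assms by (intro cSup_upper bdd_aboveI) auto

text \<open>Removing \<open>A0\<close> from \<open>A\<close> and its image from \<open>X\<close>
  removes equally many elements, so what is left of \<open>A\<close> still fits into what is left of
  \<open>X\<close>. This later places the isolated vertices of a pattern.\<close>

lemma inj_on_extension:
  assumes "finite A" "finite X" "A0 \<subseteq> A" "inj_on f A0" "f ` A0 \<subseteq> X" "card A \<le> card X"
  obtains g where "inj_on g A" "g ` A \<subseteq> X" "\<And>a. a \<in> A0 \<Longrightarrow> g a = f a"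
proof -
  have "card (A - A0) \<le> card (X - f ` A0)"
    using assms by (simp add: card_Diff_subset finite_subset card_image)
  then obtain h where h: "h ` (A - A0) \<subseteq> X - f ` A0" "inj_on h (A - A0)"
    using assms card_le_inj[of "A - A0" "X - f ` A0"] by auto
  let ?g = "\<lambda>a. if a \<in> A0 then f a else h a"
  show thesis
  proof (rule that[of ?g])
    show "inj_on ?g A"
      using assms(4) h unfolding inj_on_def by (auto split: if_splits)
    show "?g ` A \<subseteq> X" using h assms by auto
  qed auto
qed

lemma card_interval_subsets:
  assumes "finite V" "P \<subseteq> V" "Q \<subseteq> V" "P \<inter> Q = {}"
  shows "card {W \<in> Pow V. P \<subseteq> W \<and> Q \<inter> W = {}} = 2 ^ (card V - (card P + card Q))"
proof -
  have "bij_betw (\<lambda>W. P \<union> W) (Pow (V - (P \<union> Q))) {W \<in> Pow V. P \<subseteq> W \<and> Q \<inter> W = {}}"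
    by (rule bij_betw_byWitness[where f' = "\<lambda>W. W - P"]) (use assms in auto)
  then have "card {W \<in> Pow V. P \<subseteq> W \<and> Q \<inter> W = {}} = card (Pow (V - (P \<union> Q)))"
    by (simp add: bij_betw_same_card)
  also have "\<dots> = 2 ^ (card V - (card P + card Q))"
    using assms by (simp add: card_Pow card_Diff_subset finite_subset card_Un_disjoint)
  finally show ?thesis .
qed

text \<open>First moment method: a uniformly random \<open>W\<close> contains \<open>P i\<close> and
  avoids \<open>Q i\<close> with probability at least \<open>1 / 2 ^ d\<close>, so some
  \<open>W\<close> does so for at least this proportion of \<open>I\<close>. The expectation is
  written as a double count over \<open>Pow V\<close>.\<close>

lemma subset_averaging:
  assumes "finite V" "finite I"
    and PQ: "\<And>i. i \<in> I \<Longrightarrow> P i \<subseteq> V \<and> Q i \<subseteq> V \<and> P i \<inter> Q i = {} \<and> card (P i) + card (Q i) \<le> d"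
  obtains W where "W \<subseteq> V" "card I \<le> 2 ^ d * card {i \<in> I. P i \<subseteq> W \<and> Q i \<inter> W = {}}"
proof -
  let ?c = "\<lambda>W. card {i \<in> I. P i \<subseteq> W \<and> Q i \<inter> W = {}}"
  have "\<exists>W\<in>Pow V. card I \<le> 2 ^ d * ?c W"
  proof (rule ccontr)
    assume "\<not> ?thesis"
    then have less: "\<And>W. W \<in> Pow V \<Longrightarrow> 2 ^ d * ?c W < card I" by (meson not_le)
    have "(\<Sum>W\<in>Pow V. 2 ^ d * ?c W) < (\<Sum>W\<in>Pow V. card I)"
      by (rule sum_strict_mono) (use assms less in auto)
    also have "\<dots> = 2 ^ card V * card I" using assms by (simp add: card_Pow)
    finally have lt: "2 ^ d * (\<Sum>W\<in>Pow V. ?c W) < 2 ^ card V * card I"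
      by (simp add: sum_distrib_left)
    have "(\<Sum>W\<in>Pow V. ?c W) = (\<Sum>W\<in>Pow V. \<Sum>i | i \<in> I \<and> (P i \<subseteq> W \<and> Q i \<inter> W = {}). 1)"
      by simp
    \<comment> \<open>Double counting of the pairs \<open>(W, i)\<close>: from here on the sets
      \<open>W\<close> that are good for a fixed \<open>i\<close> are counted.\<close>
    also have "\<dots> = (\<Sum>i\<in>I. \<Sum>W | W \<in> Pow V \<and> (P i \<subseteq> W \<and> Q i \<inter> W = {}). 1)"
      by (rule sum.swap_restrict) (use assms in auto)
    also have "\<dots> = (\<Sum>i\<in>I. 2 ^ (card V - (card (P i) + card (Q i))))"
    proof (rule sum.cong)
      fix i assume "i \<in> I"
      then show "(\<Sum>W | W \<in> Pow V \<and> (P i \<subseteq> W \<and> Q i \<inter> W = {}). 1)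
          = (2::nat) ^ (card V - (card (P i) + card (Q i)))"
        using card_interval_subsets[of V "P i" "Q i"] assms by simp
    qed simp
    finally have "2 ^ d * (\<Sum>W\<in>Pow V. ?c W)
        = (\<Sum>i\<in>I. 2 ^ (d + (card V - (card (P i) + card (Q i)))))"
      by (simp add: sum_distrib_left power_add)
    moreover have "\<dots> \<ge> (\<Sum>i\<in>I. 2 ^ card V)"
    proof (rule sum_mono)
      fix i assume "i \<in> I"
      then have "card V \<le> d + (card V - (card (P i) + card (Q i)))" using PQ[of i] by linarith
      then show "(2::nat) ^ card V \<le> 2 ^ (d + (card V - (card (P i) + card (Q i))))"
        by (intro power_increasing) auto
    qed
    ultimately show False using lt by (simp add: mult.commute)
  qed
  then show thesis using that by auto
qed

subsection \<open>Embeddings and extremal numbers\<close>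

text \<open>Copies are handled as maps instead of subgraphs: the copy is the image of the map, it
  need not be induced, and maps can be composed.\<close>

definition embedding :: "('a \<Rightarrow> 'b) \<Rightarrow> 'a graph \<Rightarrow> 'b graph \<Rightarrow> bool" where
  "embedding f H G \<longleftrightarrow> inj_on f (verts H) \<and> f ` verts H \<subseteq> verts G \<and> (\<forall>e\<in>edges H. f ` e \<in> edges G)"

lemma simple_graph_image:
  assumes "simple_graph H" "inj_on f (verts H)"
  shows "simple_graph (Graph (f ` verts H) ((`) f ` edges H))"
  using assms unfolding simple_graph_def
  by (auto simp: card_image inj_on_subset)

lemma embedding_image_iff:
  assumes "simple_graph H"
  shows "(\<exists>K. subgraph K G \<and> graph_iso f H K) \<longleftrightarrow> embedding f H G"
proof
  assume "embedding f H G"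
  then show "\<exists>K. subgraph K G \<and> graph_iso f H K"
    using simple_graph_image[OF assms, of f]
    by (intro exI[of _ "Graph (f ` verts H) ((`) f ` edges H)"])
      (auto simp: embedding_def subgraph_def graph_iso_def bij_betw_def)
next
  assume "\<exists>K. subgraph K G \<and> graph_iso f H K"
  then show "embedding f H G"
    by (auto simp: embedding_def subgraph_def graph_iso_def bij_betw_def)
qed

lemma contains_copy_iff:
  assumes "simple_graph H"
  shows "contains_copy G H \<longleftrightarrow> (\<exists>f. embedding f H G)"
  using embedding_image_iff[OF assms] unfolding contains_copy_def by metis

lemma embedding_comp:
  assumes "embedding f H G" "embedding g G K"
  shows "embedding (g \<circ> f) H K"
  using assms unfolding embedding_def
  by (auto simp: image_comp[symmetric] simp del: o_apply intro: comp_inj_on inj_on_subset)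

lemma finite_edges: "simple_graph G \<Longrightarrow> finite (edges G)"
  unfolding simple_graph_def by (meson Pow_iff finite_Pow_iff finite_subset subsetI)

lemma ex_le:
  assumes "\<And>G :: nat graph. simple_graph G \<Longrightarrow> card (verts G) = n \<Longrightarrow> \<not> contains_copy G H
      \<Longrightarrow> card (edges G) \<le> M"
  shows "ex n H \<le> M"
  unfolding ex_def by (rule nat_Sup_le) (use assms in auto)

text \<open>The definition of \<open>ex\<close> only ranges over graphs on natural numbers, so
  \<open>G\<close> is first renamed along a bijection of its vertices with \<open>{..<n}\<close>; a
  copy in the renamed graph is carried back by the inverse.\<close>

lemma card_edges_le_ex:
  fixes G :: "'b graph"
  assumes "simple_graph H" "simple_graph G" "\<not> contains_copy G H"
  shows "card (edges G) \<le> ex (card (verts G)) H"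
proof -
  define n where "n = card (verts G)"
  have "finite (verts G)" using assms simple_graph_def by auto
  then obtain h where h: "bij_betw h (verts G) {..<n}"
    unfolding n_def by (metis ex_bij_betw_finite_nat atLeast0LessThan)
  let ?G' = "Graph {..<n} ((`) h ` edges G)"
  have inj: "inj_on h (verts G)" and im: "h ` verts G = {..<n}" using h by (auto simp: bij_betw_def)
  have simp': "simple_graph ?G'" using simple_graph_image[OF assms(2) inj] im by simp
  have sub: "\<And>e. e \<in> edges G \<Longrightarrow> e \<subseteq> verts G" using assms(2) by (simp add: simple_graph_def)
  have "inj_on ((`) h) (edges G)"
    using inj_on_image_eq_iff[OF inj] sub by (auto simp: inj_on_def)
  then have c: "card (edges ?G') = card (edges G)" by (simp add: card_image)
  have inv: "embedding (inv_into (verts G) h) ?G' G"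
    unfolding embedding_def using inj im sub
    by (auto simp: inj_on_inv_into inv_into_into image_inv_into_cancel inv_into_image_cancel)
  have free: "\<not> contains_copy ?G' H"
    using assms(3) embedding_comp[OF _ inv] unfolding contains_copy_iff[OF assms(1)] by blast
  have "card (edges ?G') \<le> ex n H"
    unfolding ex_def
  proof (rule le_nat_Sup)
    show "card (edges ?G') \<in> {card (edges G) |G :: nat graph.
        simple_graph G \<and> card (verts G) = n \<and> \<not> contains_copy G H}"
      using simp' free by (intro CollectI exI[of _ ?G']) auto
  next
    fix y assume "y \<in> {card (edges G) |G :: nat graph.
        simple_graph G \<and> card (verts G) = n \<and> \<not> contains_copy G H}"
    then obtain G :: "nat graph" where G: "y = card (edges G)" "simple_graph G" "card (verts G) = n"
      by auto
    \<comment> \<open>\<open>Sup\<close> on naturals is known to dominate only members of a bounded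
      set; any crude bound suffices.\<close>
    have "card (edges G) \<le> card (Pow (verts G))"
      using G(2) by (intro card_mono) (auto simp: simple_graph_def)
    then show "y \<le> 2 ^ n" using G by (simp add: card_Pow simple_graph_def)
  qed
  then show ?thesis using c n_def by simp
qed

text \<open>The \<open>2 * n\<close> vertices are cut into 8 blocks of at most
  \<open>n div 2\<close> vertices. Every edge lies in the union of two blocks, which extends to a
  set of exactly \<open>n\<close> vertices, and there are 64 ordered pairs of blocks.\<close>

lemma ex_double:
  assumes "simple_graph H" "n \<ge> 2"
  shows "ex (2 * n) H \<le> 64 * ex n H"
proof (rule ex_le)
  fix G :: "nat graph"
  assume G: "simple_graph G" "card (verts G) = 2 * n" "\<not> contains_copy G H"
  have fin: "finite (verts G)" using G simple_graph_def by auto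
  obtain b where b: "bij_betw b (verts G) {..<2 * n}"
    using ex_bij_betw_finite_nat[OF fin] G by (metis atLeast0LessThan)
  \<comment> \<open>Because of the rounding four blocks would not do (take \<open>n = 3\<close>);
    eight are enough once \<open>n \<ge> 2\<close>.\<close>
  define q where "q = n div 2"
  have q: "q > 0" "2 * q \<le> n" "2 * n \<le> 8 * q" using assms(2) unfolding q_def by auto
  define part where "part i = {x \<in> verts G. b x div q = i}" for i
  have card_part: "card (part i) \<le> q" for i
  proof -
    have "b ` part i \<subseteq> {i * q..<i * q + q}"
      unfolding part_def using q(1)
      by (auto simp: dividend_less_times_div mult.commute) (metis dividend_less_times_div mult.commute add.commute)
    moreover have "inj_on b (part i)"
      using b by (auto simp: bij_betw_def part_def inj_on_def)
    ultimately show ?thesis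
      by (metis card_image card_mono finite_atLeastLessThan card_atLeastLessThan add_diff_cancel_left')
  qed
  have "\<exists>T. part i \<union> part j \<subseteq> T \<and> T \<subseteq> verts G \<and> card T = n" for i j
  proof (rule exists_subset_between)
    show "card (part i \<union> part j) \<le> n"
      using card_Un_le[of "part i" "part j"] card_part[of i] card_part[of j] q(2) by linarith
  qed (use G fin in \<open>auto simp: part_def\<close>)
  then obtain T where T: "\<And>i j. part i \<union> part j \<subseteq> T i j \<and> T i j \<subseteq> verts G \<and> card (T i j) = n"
    by metis
  define E where "E p = {e \<in> edges G. e \<subseteq> T (fst p) (snd p)}" for p
  have E: "card (E p) \<le> ex n H" for p
  proof -
    let ?K = "Graph (T (fst p) (snd p)) (E p)"
    have K: "simple_graph ?K"
      using G(1) T finite_subset[OF _ fin] by (auto simp: simple_graph_def E_def)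
    have "embedding id ?K G" using T by (auto simp: embedding_def E_def)
    then have "\<not> contains_copy ?K H"
      using G(3) embedding_comp unfolding contains_copy_iff[OF assms(1)] by blast
    then show ?thesis using card_edges_le_ex[OF assms(1) K] T by simp
  qed
  have "edges G \<subseteq> (\<Union>p\<in>{..<8} \<times> {..<8}. E p)"
  proof
    fix e assume e: "e \<in> edges G"
    then have "card e = 2" "e \<subseteq> verts G" using G(1) by (simp_all add: simple_graph_def)
    then obtain x y where xy: "e = {x, y}" "x \<in> verts G" "y \<in> verts G"
      by (auto simp: card_2_iff)
    have lt: "b z div q < 8" if "z \<in> verts G" for z
    proof -
      have "b z < 8 * q" using bij_betwE[OF b] q(3) that by fastforce
      then show ?thesis by (simp add: less_mult_imp_div_less)
    qed
    have "x \<in> part (b x div q)" "y \<in> part (b y div q)" using xy by (auto simp: part_def)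
    then have "e \<in> E (b x div q, b y div q)"
      using T[of "b x div q" "b y div q"] e xy(1) by (auto simp: E_def)
    then show "e \<in> (\<Union>p\<in>{..<8} \<times> {..<8}. E p)" using lt xy by blast
  qed
  then have "card (edges G) \<le> card (\<Union>p\<in>{..<8::nat} \<times> {..<8::nat}. E p)"
    using finite_edges[OF G(1)] by (intro card_mono) (auto simp: E_def)
  also have "\<dots> \<le> (\<Sum>p\<in>{..<8::nat} \<times> {..<8::nat}. card (E p))"
    by (rule card_UN_le) simp
  also have "\<dots> \<le> (\<Sum>p\<in>{..<8::nat} \<times> {..<8::nat}. ex n H)" by (rule sum_mono) (rule E)
  finally show "card (edges G) \<le> 64 * ex n H" by simp
qed

lemma embedding_extension:
  assumes "simple_graph H" "simple_graph G" "card (verts H) \<le> card (verts G)"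
    and f: "inj_on f (\<Union>(edges H))" "\<And>e. e \<in> edges H \<Longrightarrow> f ` e \<in> edges G"
  shows "contains_copy G H"
proof -
  have fin: "finite (verts H)" "finite (verts G)" using assms by (auto simp: simple_graph_def)
  have sub: "\<Union>(edges H) \<subseteq> verts H" using assms by (auto simp: simple_graph_def)
  have "f ` e \<subseteq> verts G" if "e \<in> edges H" for e
    using f(2)[OF that] assms(2) by (simp add: simple_graph_def)
  then have "f ` \<Union>(edges H) \<subseteq> verts G" by blast
  then obtain g where g: "inj_on g (verts H)" "g ` verts H \<subseteq> verts G"
      "\<And>a. a \<in> \<Union>(edges H) \<Longrightarrow> g a = f a"
    using inj_on_extension[OF fin sub f(1)] assms(3) by metis
  have "g ` e = f ` e" if "e \<in> edges H" for e using g(3) that by (intro image_cong) auto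
  then have "embedding g H G" using g f(2) by (simp add: embedding_def)
  then show ?thesis using contains_copy_iff[OF assms(1)] by blast
qed

text \<open>Given room for all vertices of \<open>H\<close>, a single edge of the host already
  accommodates the at most one edge of \<open>H\<close>.\<close>

lemma ex_eq_0:
  assumes "simple_graph H" "card (edges H) \<le> 1" "card (verts H) \<le> n"
  shows "ex n H = 0"
proof -
  have "ex n H \<le> 0"
  proof (rule ex_le)
    fix G :: "nat graph"
    assume G: "simple_graph G" "card (verts G) = n" "\<not> contains_copy G H"
    have "edges G = {}"
    proof (rule ccontr)
      assume "edges G \<noteq> {}"
      then obtain e where e: "e \<in> edges G" by blast
      then have ce: "card e = 2" using G(1) by (simp add: simple_graph_def)
      have "contains_copy G H"
      proof (cases "edges H = {}")
        case True
        \<comment> \<open>The partial map has empty domain here, so its value is arbitrary.\<close>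
        then show ?thesis
          using embedding_extension[OF assms(1) G(1), of "\<lambda>_. 0"] assms(3) G(2) by simp
      next
        case False
        then have "card (edges H) = 1"
          using assms finite_edges[OF assms(1)] by (metis card_0_eq le_neq_implies_less less_one)
        then obtain d where d: "edges H = {d}" by (auto simp: card_1_singleton_iff)
        then have cd: "card d = 2" using assms(1) by (simp add: simple_graph_def)
        then obtain f where "bij_betw f d e"
          using ce by (metis bij_betw_iff_card card.infinite zero_neq_numeral)
        then show ?thesis
          using embedding_extension[OF assms(1) G(1), of f] assms(3) G(2) d e
          by (auto simp: bij_betw_def)
      qed
      then show False using G(3) by blast
    qed
    then show "card (edges G) \<le> 0" by simp
  qed
  then show ?thesis by simp
qed

subsection \<open>Sided embeddings\<close>

text \<open>Edges are recorded as a relation, so that each knows its left and its right end. For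
  disjoint sides nothing is lost when the pairs become unordered.\<close>

definition bip_graph :: "'a set \<Rightarrow> 'a set \<Rightarrow> ('a \<times> 'a) set \<Rightarrow> 'a graph" where
  "bip_graph X Y F = Graph (X \<union> Y) ((\<lambda>(x, y). {x, y}) ` F)"

definition sided_embedding ::
  "('a \<Rightarrow> 'b) \<Rightarrow> 'a graph \<Rightarrow> 'a set \<Rightarrow> 'a set \<Rightarrow> 'b set \<Rightarrow> 'b set \<Rightarrow> ('b \<times> 'b) set \<Rightarrow> bool" where
  "sided_embedding f H L R X Y F \<longleftrightarrow> inj_on f (verts H) \<and> f ` L \<subseteq> X \<and> f ` R \<subseteq> Y \<and>
     (\<forall>a\<in>L. \<forall>b\<in>R. {a, b} \<in> edges H \<longrightarrow> (f a, f b) \<in> F)"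

definition sided_free ::
  "'a graph \<Rightarrow> 'a set \<Rightarrow> 'a set \<Rightarrow> 'b set \<Rightarrow> 'b set \<Rightarrow> ('b \<times> 'b) set \<Rightarrow> bool" where
  "sided_free H L R X Y F \<longleftrightarrow> (\<nexists>f. sided_embedding f H L R X Y F)"

lemma pair_eq_disjoint:
  assumes "X \<inter> Y = {}" "x \<in> X" "x' \<in> X" "y \<in> Y" "y' \<in> Y" "{x, y} = {x', y'}"
  shows "x = x' \<and> y = y'"
  using assms by (auto simp: doubleton_eq_iff)

lemma card_edges_bip_graph:
  assumes "X \<inter> Y = {}" "F \<subseteq> X \<times> Y"
  shows "card (edges (bip_graph X Y F)) = card F"
proof -
  have "inj_on (\<lambda>(x, y). {x, y}) F"
    using assms(2) pair_eq_disjoint[OF assms(1)] by (intro inj_onI) (clarsimp, blast)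
  then show ?thesis by (simp add: bip_graph_def card_image)
qed

lemma edge_bip_graph_iff:
  assumes "X \<inter> Y = {}" "F \<subseteq> X \<times> Y" "x \<in> X" "y \<in> Y"
  shows "{x, y} \<in> edges (bip_graph X Y F) \<longleftrightarrow> (x, y) \<in> F"
proof
  assume "{x, y} \<in> edges (bip_graph X Y F)"
  then obtain x' y' where F: "(x', y') \<in> F" "{x, y} = {x', y'}" by (auto simp: bip_graph_def)
  then have "x' \<in> X" "y' \<in> Y" using assms(2) by auto
  then show "(x, y) \<in> F" using pair_eq_disjoint[OF assms(1,3) _ assms(4) _ F(2)] F(1) by simp
qed (auto simp: bip_graph_def)

lemma simple_bip_graph:
  assumes "X \<inter> Y = {}" "F \<subseteq> X \<times> Y" "finite X" "finite Y"
  shows "simple_graph (bip_graph X Y F)"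
  using assms by (fastforce simp: simple_graph_def bip_graph_def card_2_iff)

lemma bipartition_commute: "bipartition H L R \<Longrightarrow> bipartition H R L"
  unfolding bipartition_def by (metis insert_commute inf_commute sup_commute)

lemma sided_embedding_iff:
  assumes "bipartition H L R" "X \<inter> Y = {}" "F \<subseteq> X \<times> Y"
  shows "sided_embedding f H L R X Y F \<longleftrightarrow>
    embedding f H (bip_graph X Y F) \<and> f ` L \<subseteq> X \<and> f ` R \<subseteq> Y"
proof (cases "f ` L \<subseteq> X \<and> f ` R \<subseteq> Y")
  case True
  have "(\<forall>e\<in>edges H. f ` e \<in> edges (bip_graph X Y F)) \<longleftrightarrow>
    (\<forall>a\<in>L. \<forall>b\<in>R. {a, b} \<in> edges H \<longrightarrow> {f a, f b} \<in> edges (bip_graph X Y F))"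
  proof
    assume e: "\<forall>a\<in>L. \<forall>b\<in>R. {a, b} \<in> edges H \<longrightarrow> {f a, f b} \<in> edges (bip_graph X Y F)"
    show "\<forall>e\<in>edges H. f ` e \<in> edges (bip_graph X Y F)"
    proof
      fix d assume d: "d \<in> edges H"
      then obtain a b where "a \<in> L" "b \<in> R" "d = {a, b}"
        using assms(1) by (auto simp: bipartition_def)
      then show "f ` d \<in> edges (bip_graph X Y F)" using e d by auto
    qed
  qed force
  also have "\<dots> \<longleftrightarrow> (\<forall>a\<in>L. \<forall>b\<in>R. {a, b} \<in> edges H \<longrightarrow> (f a, f b) \<in> F)"
    using True edge_bip_graph_iff[OF assms(2,3)] by (auto simp: image_subset_iff)
  moreover have "f ` verts H \<subseteq> verts (bip_graph X Y F)"
  proof -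
    have "f ` verts H = f ` L \<union> f ` R" using assms(1) by (metis bipartition_def image_Un)
    then show ?thesis using True by (auto simp: bip_graph_def)
  qed
  ultimately show ?thesis using True by (simp add: sided_embedding_def embedding_def)
qed (auto simp: sided_embedding_def)

lemma contains_copy_sided_iff:
  assumes "simple_graph H" "bipartition H L R" "X \<inter> Y = {}" "F \<subseteq> X \<times> Y"
  shows "contains_copy_sided (bip_graph X Y F) X Y H L R \<longleftrightarrow> \<not> sided_free H L R X Y F"
  unfolding contains_copy_sided_def sided_free_def sided_embedding_iff[OF assms(2-)]
    embedding_image_iff[OF assms(1), symmetric] by blast

section \<open>Bipartite extremal numbers as suprema over relations\<close>

lemma left_right_part:
  "left_part n \<inter> right_part m = {}" "finite (left_part n)" "finite (right_part m)"
  "card (left_part n) = n" "card (right_part m) = m"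
  by (auto simp: left_part_def right_part_def card_image)

text \<open>This turns both bipartite extremal problems into problems about relations between the
  two parts.\<close>

lemma spanning_subgraph_complete_bipartite_iff:
  "spanning_subgraph G (complete_bipartite n m) \<longleftrightarrow>
    (\<exists>F\<subseteq>left_part n \<times> right_part m. G = bip_graph (left_part n) (right_part m) F)"
proof
  assume G: "spanning_subgraph G (complete_bipartite n m)"
  let ?F = "{(x, y) \<in> left_part n \<times> right_part m. {x, y} \<in> edges G}"
  have "edges G \<subseteq> {{x, y} |x y. x \<in> left_part n \<and> y \<in> right_part m}"
    "verts G = left_part n \<union> right_part m"
    using G by (auto simp: spanning_subgraph_def subgraph_def complete_bipartite_def)
  then have "edges G = (\<lambda>(x, y). {x, y}) ` ?F" by (fastforce simp: image_iff)
  then have "G = bip_graph (left_part n) (right_part m) ?F"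
    using \<open>verts G = _\<close> by (cases G) (simp add: bip_graph_def)
  then show "\<exists>F\<subseteq>left_part n \<times> right_part m. G = bip_graph (left_part n) (right_part m) F"
    by (intro exI[of _ ?F]) auto
next
  assume "\<exists>F\<subseteq>left_part n \<times> right_part m. G = bip_graph (left_part n) (right_part m) F"
  then obtain F where F: "F \<subseteq> left_part n \<times> right_part m"
    "G = bip_graph (left_part n) (right_part m) F" by blast
  then show "spanning_subgraph G (complete_bipartite n m)"
    using simple_bip_graph[OF left_right_part(1) F(1)] left_right_part
    by (auto simp: spanning_subgraph_def subgraph_def complete_bipartite_def bip_graph_def)
qed

lemma zarankiewicz_eq:
  assumes "simple_graph H" "bipartition H L R"
  shows "zarankiewicz n m H L R = Sup {card F |F. F \<subseteq> left_part n \<times> right_part m \<and>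
    sided_free H L R (left_part n) (right_part m) F}"
proof -
  let ?b = "bip_graph (left_part n) (right_part m)"
  have "{card (edges G) |G. spanning_subgraph G (complete_bipartite n m) \<and>
      \<not> contains_copy_sided G (left_part n) (right_part m) H L R} =
    {x. \<exists>F\<subseteq>left_part n \<times> right_part m. x = card (edges (?b F)) \<and>
      \<not> contains_copy_sided (?b F) (left_part n) (right_part m) H L R}"
    unfolding spanning_subgraph_complete_bipartite_iff by blast
  also have "\<dots> = {x. \<exists>F\<subseteq>left_part n \<times> right_part m. x = card F \<and>
      sided_free H L R (left_part n) (right_part m) F}"
    by (simp add: contains_copy_sided_iff[OF assms left_right_part(1)]
        card_edges_bip_graph[OF left_right_part(1)] cong: conj_cong)
  also have "\<dots> = {card F |F. F \<subseteq> left_part n \<times> right_part m \<and>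
      sided_free H L R (left_part n) (right_part m) F}" by blast
  finally show ?thesis unfolding zarankiewicz_def by simp
qed

lemma ex_bip_eq:
  "ex_bip n m H = Sup {card F |F. F \<subseteq> left_part n \<times> right_part m \<and>
    \<not> contains_copy (bip_graph (left_part n) (right_part m) F) H}"
proof -
  let ?b = "bip_graph (left_part n) (right_part m)"
  have "{card (edges G) |G. spanning_subgraph G (complete_bipartite n m) \<and> \<not> contains_copy G H} =
    {x. \<exists>F\<subseteq>left_part n \<times> right_part m. x = card (edges (?b F)) \<and> \<not> contains_copy (?b F) H}"
    unfolding spanning_subgraph_complete_bipartite_iff by blast
  also have "\<dots> = {x. \<exists>F\<subseteq>left_part n \<times> right_part m. x = card F \<and> \<not> contains_copy (?b F) H}"
    by (simp add: card_edges_bip_graph[OF left_right_part(1)] cong: conj_cong)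
  also have "\<dots> = {card F |F. F \<subseteq> left_part n \<times> right_part m \<and> \<not> contains_copy (?b F) H}"
    by blast
  finally show ?thesis unfolding ex_bip_def by simp
qed

lemma card_left_right_le:
  assumes "F \<subseteq> left_part n \<times> right_part m"
  shows "card F \<le> n * m"
  using card_mono[OF _ assms] by (simp add: left_right_part card_cartesian_product)

lemma zarankiewicz_le:
  assumes "simple_graph H" "bipartition H L R"
    and "\<And>F. F \<subseteq> left_part n \<times> right_part m \<Longrightarrow>
      sided_free H L R (left_part n) (right_part m) F \<Longrightarrow> card F \<le> M"
  shows "zarankiewicz n m H L R \<le> M"
  unfolding zarankiewicz_eq[OF assms(1,2)] by (rule nat_Sup_le) (use assms(3) in auto)

lemma card_le_zarankiewicz:
  assumes "simple_graph H" "bipartition H L R" "F \<subseteq> left_part n \<times> right_part m"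
    "sided_free H L R (left_part n) (right_part m) F"
  shows "card F \<le> zarankiewicz n m H L R"
  unfolding zarankiewicz_eq[OF assms(1,2)]
  by (rule le_nat_Sup[where M = "n * m"]) (use assms card_left_right_le in auto)

lemma ex_bip_le:
  assumes "\<And>F. F \<subseteq> left_part n \<times> right_part m \<Longrightarrow>
      \<not> contains_copy (bip_graph (left_part n) (right_part m) F) H \<Longrightarrow> card F \<le> M"
  shows "ex_bip n m H \<le> M"
  unfolding ex_bip_eq by (rule nat_Sup_le) (use assms in auto)

lemma card_le_ex_bip:
  assumes "F \<subseteq> left_part n \<times> right_part m"
    "\<not> contains_copy (bip_graph (left_part n) (right_part m) F) H"
  shows "card F \<le> ex_bip n m H"
  unfolding ex_bip_eq
  by (rule le_nat_Sup[where M = "n * m"]) (use assms card_left_right_le in auto)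

text \<open>A sided copy is in particular a copy, so avoiding all copies is the stronger
  condition.\<close>

lemma ex_bip_le_zarankiewicz:
  assumes "simple_graph H" "bipartition H L R"
  shows "ex_bip n m H \<le> zarankiewicz n m H L R"
proof (rule ex_bip_le)
  fix F assume F: "F \<subseteq> left_part n \<times> right_part m"
    "\<not> contains_copy (bip_graph (left_part n) (right_part m) F) H"
  then have "sided_free H L R (left_part n) (right_part m) F"
    unfolding sided_free_def sided_embedding_iff[OF assms(2) left_right_part(1) F(1)]
      contains_copy_iff[OF assms(1)] by blast
  then show "card F \<le> zarankiewicz n m H L R" using card_le_zarankiewicz[OF assms F(1)] by blast
qed

lemma card_verts_bip_graph: "card (verts (bip_graph (left_part n) (right_part m) F)) = n + m"
  by (simp add: bip_graph_def card_Un_disjoint left_right_part)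

lemma ex_bip_le_ex:
  assumes "simple_graph H"
  shows "ex_bip n n H \<le> ex (2 * n) H"
proof (rule ex_bip_le)
  fix F assume F: "F \<subseteq> left_part n \<times> right_part n"
    "\<not> contains_copy (bip_graph (left_part n) (right_part n) F) H"
  then show "card F \<le> ex (2 * n) H"
    using card_edges_le_ex[OF assms simple_bip_graph[OF left_right_part(1) F(1)]]
    by (simp add: left_right_part card_edges_bip_graph card_verts_bip_graph mult_2)
qed

text \<open>Two distinct edges of \<open>H\<close> are either disjoint, and then a star contains no
  copy of \<open>H\<close>, or adjacent, and then a perfect matching contains none. This linear
  lower bound is what absorbs the linear error terms later.\<close>

lemma le_ex_bip:
  assumes "simple_graph H" "card (edges H) \<ge> 2"
  shows "n \<le> ex_bip n n H"
proof -
  obtain d e where de: "d \<in> edges H" "e \<in> edges H" "d \<noteq> e"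
    using assms(2) by (metis card_le_Suc0_iff_eq finite_edges[OF assms(1)] not_less_eq_eq numeral_2_eq_2)
  then have sub: "d \<subseteq> verts H" "e \<subseteq> verts H" using assms(1) by (auto simp: simple_graph_def)
  define M where "M = (\<lambda>i. (Inl i, Inr i) :: (nat + nat) \<times> (nat + nat)) ` {..<n}"
  define S where "S = (\<lambda>i. (Inl 0, Inr i) :: (nat + nat) \<times> (nat + nat)) ` {..<n}"
  define F where "F = (if d \<inter> e = {} then S else M)"
  have c: "card F = n"
    unfolding F_def S_def M_def by (auto simp: card_image inj_on_def)
  have FX: "F \<subseteq> left_part n \<times> right_part n"
    by (auto simp: F_def S_def M_def left_part_def right_part_def)
  have "\<not> embedding f H (bip_graph (left_part n) (right_part n) F)" for f
  proof
    assume f: "embedding f H (bip_graph (left_part n) (right_part n) F)"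
    then have inj: "inj_on f (verts H)" by (simp add: embedding_def)
    from f de have im: "f ` d \<in> (\<lambda>(x, y). {x, y}) ` F" "f ` e \<in> (\<lambda>(x, y). {x, y}) ` F"
      by (auto simp: embedding_def bip_graph_def)
    have ne: "f ` d \<noteq> f ` e" using inj_on_image_eq_iff[OF inj sub] de by simp
    show False
    proof (cases "d \<inter> e = {}")
      case True
      have "f ` d \<inter> f ` e = {}" using inj_on_image_Int[OF inj sub] True by simp
      then show False using im True by (auto simp: F_def S_def)
    next
      case False
      then have "f ` d \<inter> f ` e \<noteq> {}" by blast
      moreover obtain i j where "f ` d = {Inl i, Inr i}" "f ` e = {Inl j, Inr j}"
        using im False by (auto simp: F_def M_def)
      ultimately show False using ne by auto
    qed
  qed
  then show ?thesis using card_le_ex_bip[OF FX] c contains_copy_iff[OF assms(1)] by metis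
qed

section \<open>Isolated vertices and smaller sides\<close>

text \<open>The sided form of the extension principle: the two sides are extended separately, and
  disjointness of \<open>X\<close> and \<open>Y\<close> makes the union of the two extensions
  injective.\<close>

lemma sided_embedding_extension:
  assumes "simple_graph H" "bipartition H L R" "X \<inter> Y = {}" "F \<subseteq> X \<times> Y" "finite X" "finite Y"
    and card: "card (verts H) \<le> card X" "card (verts H) \<le> card Y"
    and f: "inj_on f (\<Union>(edges H))"
      "\<And>a b. a \<in> L \<Longrightarrow> b \<in> R \<Longrightarrow> {a, b} \<in> edges H \<Longrightarrow> (f a, f b) \<in> F"
  shows "\<not> sided_free H L R X Y F"
proof -
  have LR: "L \<inter> R = {}" "L \<union> R = verts H" using assms(2) by (auto simp: bipartition_def)
  have fin: "finite (verts H)" using assms(1) by (auto simp: simple_graph_def)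
  have sub: "L \<subseteq> verts H" "R \<subseteq> verts H" using LR(2) by auto
  have ed: "\<exists>a\<in>L. \<exists>b\<in>R. e = {a, b}" if "e \<in> edges H" for e
    using assms(2) that by (auto simp: bipartition_def)
  have "finite L" "finite R" using fin LR(2) by (metis finite_Un)+
  moreover have "card L \<le> card X" "card R \<le> card Y"
    using card_mono[OF fin, of L] card_mono[OF fin, of R] card sub by linarith+
  \<comment> \<open>A non-isolated vertex lands on the correct side because its edge is sent into
    \<open>F\<close>.\<close>
  moreover have "f a \<in> X" if in_part: "a \<in> L \<inter> \<Union>(edges H)" for a
  proof -
    from in_part obtain e where e: "e \<in> edges H" "a \<in> e" by auto
    then obtain b where "b \<in> R" "e = {a, b}" using ed[OF e(1)] in_part LR(1) by auto
    then show ?thesis using f(2)[of a b] e in_part assms(4) by auto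
  qed
  moreover have "f b \<in> Y" if in_part: "b \<in> R \<inter> \<Union>(edges H)" for b
  proof -
    from in_part obtain e where e: "e \<in> edges H" "b \<in> e" by auto
    then obtain a where "a \<in> L" "e = {a, b}" using ed[OF e(1)] in_part LR(1) by auto
    then show ?thesis using f(2)[of a b] e in_part assms(4) by auto
  qed
  moreover have "inj_on f (L \<inter> \<Union>(edges H))" "inj_on f (R \<inter> \<Union>(edges H))"
    using f(1) by (auto intro: inj_on_subset)
  ultimately obtain g h where g: "inj_on g L" "g ` L \<subseteq> X" "\<And>a. a \<in> L \<inter> \<Union>(edges H) \<Longrightarrow> g a = f a"
    and h: "inj_on h R" "h ` R \<subseteq> Y" "\<And>a. a \<in> R \<inter> \<Union>(edges H) \<Longrightarrow> h a = f a"
    using inj_on_extension[of L X "L \<inter> \<Union>(edges H)" f] inj_on_extension[of R Y "R \<inter> \<Union>(edges H)" f]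
      assms(5,6) by (metis image_subsetI inf_le1)
  let ?k = "\<lambda>a. if a \<in> L then g a else h a"
  have kL: "?k a = g a" if "a \<in> L" for a using that by simp
  have kR: "?k a = h a" if "a \<in> R" for a using that LR(1) by auto
  have im: "?k ` L \<subseteq> X" "?k ` R \<subseteq> Y" using g(2) h(2) kL kR by (auto simp: image_subset_iff)
  have "inj_on ?k L" "inj_on ?k R"
    using g(1) h(1) kL kR by (simp_all add: inj_on_def)
  then have "inj_on ?k (L \<union> R)" using im assms(3) by (subst inj_on_Un) blast
  moreover have "(?k a, ?k b) \<in> F" if ab: "a \<in> L" "b \<in> R" "{a, b} \<in> edges H" for a b
  proof -
    have "a \<in> \<Union>(edges H)" "b \<in> \<Union>(edges H)" using ab(3) by blast+
    then have "?k a = f a" "?k b = f b" using g(3) h(3) kL[OF ab(1)] kR[OF ab(2)] ab by auto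
    then show ?thesis using f(2)[OF ab] by simp
  qed
  ultimately have "sided_embedding ?k H L R X Y F"
    using im LR(2) unfolding sided_embedding_def by simp
  then show ?thesis unfolding sided_free_def by blast
qed

lemma zarankiewicz_eq_0:
  assumes "simple_graph H" "bipartition H L R" "card (edges H) \<le> 1" "card (verts H) \<le> n"
  shows "zarankiewicz n n H L R = 0"
proof -
  have "zarankiewicz n n H L R \<le> 0"
  proof (rule zarankiewicz_le[OF assms(1,2)])
    fix F assume F: "F \<subseteq> left_part n \<times> right_part n"
      "sided_free H L R (left_part n) (right_part n) F"
    have LR: "L \<inter> R = {}" using assms(2) by (auto simp: bipartition_def)
    have "F = {}"
    proof (rule ccontr)
      assume "F \<noteq> {}"
      then obtain p q where pq: "(p, q) \<in> F" by auto
      then have "p \<noteq> q" using F(1) left_right_part(1) by blast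
      have eq: "d = e" if "d \<in> edges H" "e \<in> edges H" for d e
        using assms(3) finite_edges[OF assms(1)] that by (metis One_nat_def card_le_Suc0_iff_eq)
      \<comment> \<open>All non-isolated vertices lie on one edge, whose ends have different sides;
        hence the side determines the vertex.\<close>
      have "inj_on (\<lambda>a. if a \<in> L then p else q) (\<Union>(edges H))"
      proof (rule inj_onI)
        fix a b assume ab: "a \<in> \<Union>(edges H)" "b \<in> \<Union>(edges H)"
          "(if a \<in> L then p else q) = (if b \<in> L then p else q)"
        then obtain e where e: "e \<in> edges H" "a \<in> e" "b \<in> e" using eq by blast
        then obtain x y where "x \<in> L" "y \<in> R" "e = {x, y}"
          using assms(2) by (auto simp: bipartition_def)
        then show "a = b" using e ab(3) LR \<open>p \<noteq> q\<close> by (auto split: if_splits)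
      qed
      moreover have "(if a \<in> L then p else q, if b \<in> L then p else q) \<in> F"
        if "a \<in> L" "b \<in> R" for a b
        using that pq LR by auto
      ultimately have "\<not> sided_free H L R (left_part n) (right_part n) F"
        using sided_embedding_extension[OF assms(1,2) left_right_part(1) F(1) left_right_part(2,3)]
          assms(4) unfolding left_right_part(4,5) by blast
      then show False using F(2) by blast
    qed
    then show "card F \<le> 0" by simp
  qed
  then show ?thesis by simp
qed

text \<open>Enlarging the sides to size \<open>n\<close> can create copies only by giving room to
  isolated vertices of \<open>H\<close>. If both sides have at least \<open>card (verts H)\<close>
  vertices, this room was there before; otherwise \<open>F\<close> has at most
  \<open>card (verts H) * n\<close> pairs, which is the error term.\<close>

lemma card_le_zarankiewicz_add:
  assumes H: "simple_graph H" "bipartition H L R"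
    and XY: "X \<inter> Y = {}" "F \<subseteq> X \<times> Y" "finite X" "finite Y" "card X \<le> n" "card Y \<le> n"
    and free: "sided_free H L R X Y F"
  shows "card F \<le> zarankiewicz n n H L R + card (verts H) * n"
proof (rule ccontr)
  assume "\<not> ?thesis"
  then have gt: "card F > zarankiewicz n n H L R + card (verts H) * n" by simp
  have "card F \<le> card X * card Y"
    using card_mono[OF _ XY(2)] XY(3,4) by (simp add: card_cartesian_product)
  then have "card (verts H) * n < card X * card Y" using gt by linarith
  then have cX: "card (verts H) \<le> card X" and cY: "card (verts H) \<le> card Y"
    using XY(5,6) by (metis leI less_imp_le mult_le_mono mult.commute not_le)+
  obtain p where p: "p ` X \<subseteq> left_part n" "inj_on p X"
    using card_le_inj[of X "left_part n"] XY by (auto simp: left_right_part)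
  obtain q where q: "q ` Y \<subseteq> right_part n" "inj_on q Y"
    using card_le_inj[of Y "right_part n"] XY by (auto simp: left_right_part)
  define h where "h z = (if z \<in> X then p z else q z)" for z
  have hX: "h ` X \<subseteq> left_part n" and hY: "h ` Y \<subseteq> right_part n"
    using p q XY(1) by (auto simp: h_def)
  have "inj_on h X" using p(2) by (simp add: h_def inj_on_def)
  moreover have hq: "h y = q y" if "y \<in> Y" for y using that XY(1) by (auto simp: h_def)
  then have "inj_on h Y" using q(2) by (simp add: inj_on_def)
  ultimately have h: "inj_on h (X \<union> Y)"
    using hX hY left_right_part(1)[of n n] by (subst inj_on_Un) blast
  define F' where "F' = map_prod h h ` F"
  have F': "F' \<subseteq> left_part n \<times> right_part n"
    unfolding F'_def using hX hY XY(2) by (auto simp: image_subset_iff)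
  have "inj_on (map_prod h h) F"
  proof (rule inj_onI)
    fix a b assume "a \<in> F" "b \<in> F" "map_prod h h a = map_prod h h b"
    then show "a = b" using XY(2) inj_onD[OF h] by (cases a; cases b) auto
  qed
  then have "card F' = card F" by (simp add: F'_def card_image)
  then have "\<not> sided_free H L R (left_part n) (right_part n) F'"
    using card_le_zarankiewicz[OF H F'] gt by auto
  then obtain f where f: "sided_embedding f H L R (left_part n) (right_part n) F'"
    by (auto simp: sided_free_def)
  let ?g = "inv_into (X \<union> Y) h"
  have fed: "f a \<in> h ` (X \<union> Y)" "f b \<in> h ` (X \<union> Y)" "(?g (f a), ?g (f b)) \<in> F"
    if "a \<in> L" "b \<in> R" "{a, b} \<in> edges H" for a b
  proof -
    have "(f a, f b) \<in> F'" using f that by (auto simp: sided_embedding_def)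
    then obtain x y where xy: "(x, y) \<in> F" "f a = h x" "f b = h y" by (auto simp: F'_def)
    then have "x \<in> X \<union> Y" "y \<in> X \<union> Y" using XY(2) by auto
    then show "f a \<in> h ` (X \<union> Y)" "f b \<in> h ` (X \<union> Y)" "(?g (f a), ?g (f b)) \<in> F"
      using xy h by auto
  qed
  \<comment> \<open>Isolated vertices of the copy may lie outside the image of \<open>h\<close>, so
    only the ends of edges are pulled back.\<close>
  have "f ` \<Union>(edges H) \<subseteq> h ` (X \<union> Y)"
  proof
    fix z assume "z \<in> f ` \<Union>(edges H)"
    then obtain e where e: "e \<in> edges H" "z \<in> f ` e" by auto
    then obtain a b where "a \<in> L" "b \<in> R" "e = {a, b}"
      using H(2) by (auto simp: bipartition_def)
    then show "z \<in> h ` (X \<union> Y)" using fed e by auto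
  qed
  moreover have "inj_on f (\<Union>(edges H))"
    using f H(1) by (auto simp: sided_embedding_def simple_graph_def intro!: inj_on_subset[of f "verts H"])
  ultimately have "inj_on (?g \<circ> f) (\<Union>(edges H))"
    using inj_on_inv_into by (intro comp_inj_on) auto
  then have "\<not> sided_free H L R X Y F"
    using sided_embedding_extension[OF H XY(1-4) cX cY, of "?g \<circ> f"] fed by auto
  then show False using free by blast
qed

section \<open>Bipartite subgraphs and monotonicity\<close>

text \<open>A random cut: after an arbitrary ordering of its ends, each edge crosses from
  \<open>W\<close> to the complement in that direction with probability 1/4. Fixing the direction
  costs a factor 2 against the usual bound and is harmless.\<close>

lemma bipartite_subgraph:
  assumes "simple_graph G"
  obtains X Y where "X \<inter> Y = {}" "X \<union> Y = verts G"
    "card (edges G) \<le> 4 * card {(x, y) \<in> X \<times> Y. {x, y} \<in> edges G}"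
proof -
  have fin: "finite (verts G)" using assms by (auto simp: simple_graph_def)
  have "\<exists>x y. e = {x, y} \<and> x \<noteq> y" if "e \<in> edges G" for e
    using assms that unfolding simple_graph_def by (metis card_2_iff)
  then obtain x y where xy: "\<And>e. e \<in> edges G \<Longrightarrow> e = {x e, y e} \<and> x e \<noteq> y e" by metis
  have sub: "e \<subseteq> verts G" if "e \<in> edges G" for e using assms that by (auto simp: simple_graph_def)
  obtain W where W: "W \<subseteq> verts G"
    "card (edges G) \<le> 2 ^ 2 * card {e \<in> edges G. {x e} \<subseteq> W \<and> {y e} \<inter> W = {}}"
  proof (rule subset_averaging[OF fin finite_edges[OF assms]])
    fix e assume "e \<in> edges G"
    then show "{x e} \<subseteq> verts G \<and> {y e} \<subseteq> verts G \<and> {x e} \<inter> {y e} = {} \<and> card {x e} + card {y e} \<le> 2"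
      using xy[of e] sub[of e] by auto
  qed
  let ?S = "{e \<in> edges G. {x e} \<subseteq> W \<and> {y e} \<inter> W = {}}"
  let ?F = "{(x, y) \<in> W \<times> (verts G - W). {x, y} \<in> edges G}"
  have inj: "inj_on (\<lambda>e. (x e, y e)) ?S"
    by (rule inj_onI) (metis (no_types, lifting) Pair_inject mem_Collect_eq xy)
  have im: "(\<lambda>e. (x e, y e)) ` ?S \<subseteq> ?F"
  proof
    fix z assume "z \<in> (\<lambda>e. (x e, y e)) ` ?S"
    then obtain e where e: "e \<in> edges G" "x e \<in> W" "y e \<notin> W" "z = (x e, y e)" by auto
    have "{x e, y e} \<in> edges G" using xy[OF e(1)] e(1) by simp
    moreover have "x e \<in> verts G" "y e \<in> verts G" using xy[OF e(1)] sub[OF e(1)] by blast+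
    ultimately show "z \<in> ?F" using e by simp
  qed
  have "?F \<subseteq> verts G \<times> verts G" using W(1) by auto
  then have "finite ?F" using fin by (meson finite_SigmaI finite_subset)
  then have "card ?S \<le> card ?F" using card_mono[OF _ im] card_image[OF inj] by simp
  then have "card (edges G) \<le> 4 * card ?F" using W(2) by simp
  then show thesis using W(1) by (intro that[of W "verts G - W"]) auto
qed

text \<open>A large cut of \<open>G\<close> is placed into the complete bipartite graph, whose sides
  are big enough for any cut of \<open>n\<close> vertices. Copies of \<open>H\<close> there return
  to \<open>G\<close>, where \<open>card (verts H) \<le> n\<close> leaves room for isolated
  vertices.\<close>

lemma ex_le_ex_bip:
  assumes "simple_graph H" "card (verts H) \<le> n"
  shows "ex n H \<le> 4 * ex_bip n n H"
proof (rule ex_le)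
  fix G :: "nat graph"
  assume G: "simple_graph G" "card (verts G) = n" "\<not> contains_copy G H"
  obtain X Y where XY: "X \<inter> Y = {}" "X \<union> Y = verts G"
    and le: "card (edges G) \<le> 4 * card {(x, y) \<in> X \<times> Y. {x, y} \<in> edges G}" (is "_ \<le> 4 * card ?F")
    using bipartite_subgraph[OF G(1)] by blast
  have fin: "finite (verts G)" using G by (auto simp: simple_graph_def)
  then have fXY: "finite X" "finite Y" using XY(2) by (metis finite_Un)+
  have cXY: "card X \<le> n" "card Y \<le> n"
    using card_mono[OF fin, of X] card_mono[OF fin, of Y] XY(2) G(2) by auto
  obtain p where p: "p ` X \<subseteq> left_part n" "inj_on p X"
    using card_le_inj[of X "left_part n"] fXY cXY by (auto simp: left_right_part)
  obtain q where q: "q ` Y \<subseteq> right_part n" "inj_on q Y"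
    using card_le_inj[of Y "right_part n"] fXY cXY by (auto simp: left_right_part)
  define F where "F = map_prod p q ` ?F"
  have F: "F \<subseteq> left_part n \<times> right_part n" using p q by (auto simp: F_def)
  have "inj_on (map_prod p q) ?F"
    using p(2) q(2) by (auto simp: inj_on_def)
  then have cF: "card F = card ?F" by (simp add: F_def card_image)
  let ?G = "bip_graph (left_part n) (right_part n) F"
  define h where "h z = (if z \<in> left_part n then inv_into X p z else inv_into Y q z)" for z
  have "\<not> contains_copy ?G H"
  proof
    assume "contains_copy ?G H"
    then obtain f where f: "embedding f H ?G" using contains_copy_iff[OF assms(1)] by blast
    have inj: "inj_on h (p ` X \<union> q ` Y)"
    proof (rule inj_onI)
      fix a b assume "a \<in> p ` X \<union> q ` Y" "b \<in> p ` X \<union> q ` Y" "h a = h b"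
      then show "a = b"
        using p q left_right_part(1)[of n n] XY(1) unfolding h_def
        by (auto split: if_splits)
    qed
    have ed: "\<exists>x\<in>X. \<exists>y\<in>Y. f ` e = {p x, q y} \<and> {x, y} \<in> edges G" if "e \<in> edges H" for e
    proof -
      have "f ` e \<in> edges ?G" using f that by (auto simp: embedding_def)
      then show ?thesis by (auto simp: bip_graph_def F_def)
    qed
    have "contains_copy G H"
    proof (rule embedding_extension[OF assms(1) G(1), of "h \<circ> f"])
      have "inj_on f (\<Union>(edges H))"
        using f assms(1) by (auto simp: embedding_def simple_graph_def intro!: inj_on_subset[of f "verts H"])
      moreover have "f ` \<Union>(edges H) \<subseteq> p ` X \<union> q ` Y"
      proof
        fix z assume "z \<in> f ` \<Union>(edges H)"
        then obtain e where "e \<in> edges H" "z \<in> f ` e" by auto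
        then show "z \<in> p ` X \<union> q ` Y" using ed[of e] by auto
      qed
      ultimately show "inj_on (h \<circ> f) (\<Union>(edges H))"
        using inj by (intro comp_inj_on) (auto intro: inj_on_subset)
    next
      fix e assume "e \<in> edges H"
      then obtain x y where xy: "x \<in> X" "y \<in> Y" "f ` e = {p x, q y}" "{x, y} \<in> edges G"
        using ed by blast
      have "p x \<in> left_part n" "q y \<notin> left_part n"
        using p q xy left_right_part(1)[of n n] by auto
      then have "h (p x) = x" "h (q y) = y" using p q xy by (auto simp: h_def)
      then show "(h \<circ> f) ` e \<in> edges G" using xy by (simp add: image_comp[symmetric] del: o_apply)
    qed (use assms G in auto)
    then show False using G(3) by blast
  qed
  then have "card ?F \<le> ex_bip n n H" using card_le_ex_bip[OF F] cF by simp
  then show "card (edges G) \<le> 4 * ex_bip n n H" using le by linarith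
qed

lemma ex_mono:
  assumes "simple_graph H" "simple_graph K" "embedding i H K"
  shows "ex n H \<le> ex n K"
proof (rule ex_le)
  fix G :: "nat graph"
  assume G: "simple_graph G" "card (verts G) = n" "\<not> contains_copy G H"
  then have "\<not> contains_copy G K"
    using embedding_comp[OF assms(3)] contains_copy_iff[OF assms(1)] contains_copy_iff[OF assms(2)]
    by blast
  then show "card (edges G) \<le> ex n K" using card_edges_le_ex[OF assms(2) G(1)] G(2) by simp
qed

lemma ex_bip_mono:
  assumes "simple_graph H" "simple_graph K" "embedding i H K"
  shows "ex_bip n m H \<le> ex_bip n m K"
proof (rule ex_bip_le)
  fix F
  assume F: "F \<subseteq> left_part n \<times> right_part m"
    "\<not> contains_copy (bip_graph (left_part n) (right_part m) F) H"
  then have "\<not> contains_copy (bip_graph (left_part n) (right_part m) F) K"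
    using embedding_comp[OF assms(3)] contains_copy_iff[OF assms(1)] contains_copy_iff[OF assms(2)]
    by blast
  then show "card F \<le> ex_bip n m K" using card_le_ex_bip[OF F(1)] by blast
qed

subsection \<open>Glued graphs\<close>

lemma identify_Inl: "identify u v (Inl x) = Inl x"
  by (simp add: identify_def)

lemma verts_glue: "verts (glue H1 u H2 v) = Inl ` verts H1 \<union> (identify u v \<circ> Inr) ` verts H2"
  by (simp add: glue_def image_Un image_image identify_Inl)

lemma edges_glue:
  "edges (glue H1 u H2 v) = (`) Inl ` edges H1 \<union> (`) (identify u v \<circ> Inr) ` edges H2"
proof -
  have "(`) (identify u v) ` (`) Inl ` edges H1 = (`) Inl ` edges H1"
    by (simp add: image_image identify_Inl)
  moreover have "(`) (identify u v) ` (`) Inr ` edges H2 = (`) (identify u v \<circ> Inr) ` edges H2"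
    by (simp add: image_image)
  ultimately show ?thesis by (simp add: glue_def image_Un)
qed

lemma inj_identify_Inr: "inj_on (identify u v \<circ> Inr) A"
  by (auto simp: inj_on_def identify_def)

lemma embedding_glue_left: "embedding Inl H1 (glue H1 u H2 v)"
  by (auto simp: embedding_def verts_glue edges_glue)

lemma embedding_glue_right: "embedding (identify u v \<circ> Inr) H2 (glue H1 u H2 v)"
  by (auto simp: embedding_def verts_glue edges_glue inj_identify_Inr simp del: o_apply)

lemma simple_graph_Un:
  assumes "simple_graph (Graph V E)" "simple_graph (Graph V' E')"
  shows "simple_graph (Graph (V \<union> V') (E \<union> E'))"
  using assms by (auto simp: simple_graph_def)

lemma simple_glue:
  assumes "simple_graph H1" "simple_graph H2"
  shows "simple_graph (glue H1 u H2 v)"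
proof -
  have "simple_graph (Graph (Inl ` verts H1) ((`) Inl ` edges H1))"
    "simple_graph (Graph ((identify u v \<circ> Inr) ` verts H2) ((`) (identify u v \<circ> Inr) ` edges H2))"
    using assms inj_identify_Inr by (intro simple_graph_image; simp)+
  then have "simple_graph (Graph (verts (glue H1 u H2 v)) (edges (glue H1 u H2 v)))"
    unfolding verts_glue edges_glue by (rule simple_graph_Un)
  then show ?thesis by simp
qed

lemma card_edges_glue_le:
  assumes "simple_graph H1" "simple_graph H2"
  shows "card (edges (glue H1 u H2 v)) \<le> card (edges H1) + card (edges H2)"
  unfolding edges_glue
  by (meson add_mono card_Un_le card_image_le finite_edges assms order_trans)

lemma inj_on_UnI:
  assumes "inj_on f A" "inj_on f B" "f ` A \<inter> f ` B = {}"
  shows "inj_on f (A \<union> B)"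
  using assms unfolding inj_on_def by (metis Un_iff disjoint_iff imageI)

text \<open>The two embeddings agree at the root and meet nowhere else, so together they form one
  embedding of the glued graph.\<close>

lemma contains_copy_glue:
  assumes H: "simple_graph H1" "simple_graph H2" and uv: "u \<in> verts H1" "v \<in> verts H2"
    and f: "embedding f H1 G" and g: "embedding g H2 G"
    and fg: "f u = g v" "f ` verts H1 \<inter> (g ` verts H2 - {g v}) = {}"
  shows "contains_copy G (glue H1 u H2 v)"
proof -
  define h where "h = case_sum f g"
  have hl: "h \<circ> Inl = f" by (auto simp: h_def)
  \<comment> \<open>At \<open>v\<close> the renaming leads to \<open>Inl u\<close>, where
    \<open>h\<close> takes the value \<open>f u = g v\<close>.\<close>
  have hr: "h \<circ> (identify u v \<circ> Inr) = g" using fg(1) by (auto simp: h_def identify_def)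
  have "inj_on h (verts (glue H1 u H2 v))"
  proof -
    have eq: "verts (glue H1 u H2 v) = Inl ` verts H1 \<union> Inr ` (verts H2 - {v})"
      using uv by (auto simp: verts_glue identify_def)
    have fi: "inj_on f (verts H1)" and gi: "inj_on g (verts H2)"
      using f g by (auto simp: embedding_def)
    have i1: "inj_on h (Inl ` verts H1)" using fi by (auto simp: h_def inj_on_def)
    have i2: "inj_on h (Inr ` (verts H2 - {v}))" using gi by (auto simp: h_def inj_on_def)
    have "g b \<noteq> g v" if "b \<in> verts H2 - {v}" for b
      using that gi uv(2) by (auto dest: inj_onD)
    then have "g ` (verts H2 - {v}) \<subseteq> g ` verts H2 - {g v}" by auto
    then have "f ` verts H1 \<inter> g ` (verts H2 - {v}) \<subseteq> f ` verts H1 \<inter> (g ` verts H2 - {g v})"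
      by (rule Int_mono[OF order_refl])
    then have "f ` verts H1 \<inter> g ` (verts H2 - {v}) = {}" by (simp only: fg(2) subset_empty)
    then have "h ` Inl ` verts H1 \<inter> h ` Inr ` (verts H2 - {v}) = {}"
      by (simp add: h_def image_image)
    then show ?thesis unfolding eq by (rule inj_on_UnI[OF i1 i2])
  qed
  moreover have "h ` verts (glue H1 u H2 v) \<subseteq> verts G"
    using f g unfolding verts_glue image_Un image_comp hl hr by (simp add: embedding_def)
  moreover have "h ` e \<in> edges G" if "e \<in> edges (glue H1 u H2 v)" for e
  proof -
    from that consider d where "d \<in> edges H1" "e = Inl ` d"
      | d where "d \<in> edges H2" "e = (identify u v \<circ> Inr) ` d" unfolding edges_glue by blast
    then show ?thesis
    proof cases
      case 1
      then show ?thesis using f image_comp[of h Inl d] hl by (simp add: embedding_def)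
    next
      case 2
      then have "h ` e = g ` d" using image_comp[of h "identify u v \<circ> Inr" d] hr by simp
      then show ?thesis using g 2 by (simp add: embedding_def)
    qed
  qed
  ultimately have "embedding h (glue H1 u H2 v) G" by (simp add: embedding_def)
  then show ?thesis using contains_copy_iff[OF simple_glue[OF H]] by blast
qed

section \<open>Upper bound for the extremal number of a glued graph\<close>

lemma sided_embedding_mono:
  assumes "sided_embedding f H L R X Y F" "X \<subseteq> X'" "Y \<subseteq> Y'" "F \<subseteq> F'"
  shows "sided_embedding f H L R X' Y' F'"
  using assms unfolding sided_embedding_def by blast

text \<open>Left vertices that are not the image of \<open>v\<close> in a sided copy of \<open>H2\<close> are covered by the bound
  for \<open>H2\<close>. For the others fix one such copy and let \<open>S x\<close> be its vertices other than \<open>x\<close>: every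
  sided copy of \<open>H1\<close> with \<open>u\<close> at \<open>x\<close> must hit \<open>S x\<close>. Hence no sided copy of \<open>H1\<close> survives among the
  pairs inside \<open>W\<close> whose left end \<open>x\<close> satisfies \<open>S x \<inter> W = {}\<close>, and by averaging some \<open>W\<close> keeps a
  constant proportion of the pairs \<open>(x, y)\<close> with \<open>y \<notin> S x\<close>.\<close>

lemma ex_glue_le:
  assumes H: "simple_graph H1" "simple_graph H2" "bipartition H1 L1 R1" "bipartition H2 L2 R2"
    and uv: "u \<in> L1" "v \<in> L2"
  defines "k1 \<equiv> card (verts H1)" and "k2 \<equiv> card (verts H2)"
  shows "ex n (glue H1 u H2 v) \<le> 4 * ((zarankiewicz n n H2 L2 R2 + k2 * n) + k2 * n
    + 2 ^ (k2 + 2) * (zarankiewicz n n H1 L1 R1 + k1 * n))"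
proof (rule ex_le)
  fix G :: "nat graph"
  assume G: "simple_graph G" "card (verts G) = n" "\<not> contains_copy G (glue H1 u H2 v)"
  have fin: "finite (verts G)" "finite (verts H1)" "finite (verts H2)"
    using G H by (auto simp: simple_graph_def)
  have uvV: "u \<in> verts H1" "v \<in> verts H2" using H uv by (auto simp: bipartition_def)
  obtain X Y where XY: "X \<inter> Y = {}" "X \<union> Y = verts G"
    and le: "card (edges G) \<le> 4 * card {(x, y) \<in> X \<times> Y. {x, y} \<in> edges G}"
    using bipartite_subgraph[OF G(1)] by blast
  define F where "F = {(x, y) \<in> X \<times> Y. {x, y} \<in> edges G}"
  have FXY: "F \<subseteq> X \<times> Y" by (auto simp: F_def)
  have fXY: "finite X" "finite Y" using XY(2) fin by (metis finite_Un)+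
  have cXY: "card X \<le> n" "card Y \<le> n"
    using card_mono[OF fin(1), of X] card_mono[OF fin(1), of Y] XY(2) G(2) by auto
  have fF: "finite F" using FXY fXY by (meson finite_SigmaI finite_subset)
  have "embedding id (bip_graph X Y F) G"
    using XY(2) by (auto simp: embedding_def bip_graph_def F_def)
  then have emb: "embedding f H' G" if "sided_embedding f H' L R X Y F" "bipartition H' L R"
    for f L R and H' :: "'c graph"
  proof -
    have "embedding f H' (bip_graph X Y F)"
      using that(1) sided_embedding_iff[OF that(2) XY(1) FXY] by blast
    then show ?thesis using embedding_comp[OF _ \<open>embedding id _ G\<close>] by fastforce
  qed
  define X1 where "X1 = {x \<in> X. \<exists>g. sided_embedding g H2 L2 R2 X Y F \<and> g v = x}"
  have "\<forall>x\<in>X1. \<exists>g. sided_embedding g H2 L2 R2 X Y F \<and> g v = x" by (auto simp: X1_def)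
  then obtain g where g: "\<And>x. x \<in> X1 \<Longrightarrow> sided_embedding (g x) H2 L2 R2 X Y F \<and> g x v = x"
    by metis
  define S where "S x = g x ` verts H2 - {x}" for x
  have cS: "card (S x) \<le> k2" for x
    unfolding S_def k2_def using card_image_le[OF fin(3), of "g x"] card_Diff1_le[of "g x ` verts H2" x]
    by linarith
  have SV: "S x \<subseteq> verts G" if "x \<in> X1" for x
    using emb[OF conjunct1[OF g[OF that]] H(4)] by (auto simp: S_def embedding_def)
  have hit: "f ` verts H1 \<inter> S (f u) \<noteq> {}" if f: "sided_embedding f H1 L1 R1 X Y F" "f u \<in> X1" for f
  proof
    assume "f ` verts H1 \<inter> S (f u) = {}"
    moreover have "g (f u) v = f u" using g[OF f(2)] by blast
    ultimately have "contains_copy G (glue H1 u H2 v)"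
      using contains_copy_glue[OF H(1,2) uvV emb[OF f(1) H(3)] emb[OF conjunct1[OF g[OF f(2)]] H(4)]]
      by (simp add: S_def)
    then show False using G(3) by blast
  qed

  define F0 where "F0 = {(x, y) \<in> F. x \<notin> X1}"
  have "F0 \<subseteq> (X - X1) \<times> Y" using FXY by (auto simp: F0_def)
  moreover have "sided_free H2 L2 R2 (X - X1) Y F0"
    unfolding sided_free_def
  proof
    assume "\<exists>f. sided_embedding f H2 L2 R2 (X - X1) Y F0"
    then obtain f where f: "sided_embedding f H2 L2 R2 (X - X1) Y F0" by blast
    then have "sided_embedding f H2 L2 R2 X Y F"
      by (rule sided_embedding_mono) (auto simp: F0_def)
    moreover have "f v \<in> X - X1" using f uv by (auto simp: sided_embedding_def)
    ultimately show False by (auto simp: X1_def)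
  qed
  moreover have "card (X - X1) \<le> n" using cXY(1) card_mono[OF fXY(1), of "X - X1"] by auto
  ultimately have c0: "card F0 \<le> zarankiewicz n n H2 L2 R2 + k2 * n"
    unfolding k2_def using XY(1) fXY cXY by (intro card_le_zarankiewicz_add[OF H(2,4)]) auto

  define F1 where "F1 = {(x, y) \<in> F. x \<in> X1 \<and> y \<notin> S x}"
  have fX1: "finite X1" using fXY(1) by (simp add: X1_def)
  \<comment> \<open>Pairs with \<open>y \<in> S x\<close> cannot be sampled, as \<open>y\<close>
    would have to lie both inside and outside \<open>W\<close>. There are at most \<open>k2\<close>
    of them for each \<open>x\<close>.\<close>
  have "card (SIGMA x:X1. S x) = (\<Sum>x\<in>X1. card (S x))"
    using fX1 fin(3) by (intro card_SigmaI) (auto simp: S_def)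
  also have "\<dots> \<le> (\<Sum>x\<in>X1. k2)" by (rule sum_mono) (rule cS)
  also have "\<dots> \<le> k2 * n"
    using card_mono[OF fXY(1), of X1] cXY(1) by (auto simp: X1_def)
  finally have c2: "card (SIGMA x:X1. S x) \<le> k2 * n" .

  \<comment> \<open>Two vertices must be in \<open>W\<close> and at most \<open>k2\<close> must be
    outside, hence the exponent \<open>k2 + 2\<close>.\<close>
  obtain W where W: "W \<subseteq> verts G"
    "card F1 \<le> 2 ^ (k2 + 2) * card {e \<in> F1. {fst e, snd e} \<subseteq> W \<and> S (fst e) \<inter> W = {}}"
  proof (rule subset_averaging[OF fin(1)])
    show "finite F1" using fF by (rule finite_subset[rotated]) (auto simp: F1_def)
  next
    fix e assume "e \<in> F1"
    then obtain x y where e: "e = (x, y)" "(x, y) \<in> F" "x \<in> X1" "y \<notin> S x" by (auto simp: F1_def)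
    then have "x \<in> X" "y \<in> Y" using FXY by auto
    moreover have "x \<notin> S x" by (simp add: S_def)
    moreover have "card {x, y} \<le> 2" by (simp add: card_insert_if)
    ultimately show "{fst e, snd e} \<subseteq> verts G \<and> S (fst e) \<subseteq> verts G \<and>
      {fst e, snd e} \<inter> S (fst e) = {} \<and> card {fst e, snd e} + card (S (fst e)) \<le> k2 + 2"
      using e SV[of x] cS[of x] XY(2) by auto
  qed
  define F3 where "F3 = {e \<in> F1. {fst e, snd e} \<subseteq> W \<and> S (fst e) \<inter> W = {}}"
  define X3 where "X3 = {x \<in> X1 \<inter> W. S x \<inter> W = {}}"
  have F3sub: "F3 \<subseteq> X3 \<times> (Y \<inter> W)" using FXY by (auto simp: F3_def F1_def X3_def)
  have X3sub: "X3 \<subseteq> X" by (auto simp: X3_def X1_def)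
  have "sided_free H1 L1 R1 X3 (Y \<inter> W) F3"
    unfolding sided_free_def
  proof
    assume "\<exists>f. sided_embedding f H1 L1 R1 X3 (Y \<inter> W) F3"
    then obtain f where f: "sided_embedding f H1 L1 R1 X3 (Y \<inter> W) F3" by blast
    then have f': "sided_embedding f H1 L1 R1 X Y F"
      by (rule sided_embedding_mono) (use X3sub in \<open>auto simp: F3_def F1_def\<close>)
    have fu: "f u \<in> X3" using f uv by (auto simp: sided_embedding_def)
    have "f ` verts H1 = f ` L1 \<union> f ` R1" using H(3) by (metis bipartition_def image_Un)
    then have "f ` verts H1 \<subseteq> W" using f by (auto simp: sided_embedding_def X3_def)
    moreover have "f ` verts H1 \<inter> S (f u) \<noteq> {}" using hit[OF f'] fu by (simp add: X3_def)
    ultimately show False using fu by (auto simp: X3_def)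
  qed
  moreover have "card X3 \<le> n" "card (Y \<inter> W) \<le> n"
    using cXY card_mono[OF fXY(1) X3sub] card_mono[OF fXY(2), of "Y \<inter> W"] by auto
  moreover have "finite X3" using fXY X3sub finite_subset by blast
  ultimately have c3: "card F3 \<le> zarankiewicz n n H1 L1 R1 + k1 * n"
    unfolding k1_def using F3sub XY(1) X3sub fXY
    by (intro card_le_zarankiewicz_add[OF H(1,3)]) auto

  \<comment> \<open>Three kinds of pairs: \<open>x\<close> is no root of a sided copy of
    \<open>H2\<close>; \<open>x\<close> is a root and \<open>y \<in> S x\<close>; \<open>x\<close>
    is a root and \<open>y \<notin> S x\<close>.\<close>
  have "F \<subseteq> F0 \<union> (SIGMA x:X1. S x) \<union> F1" by (auto simp: F0_def F1_def)
  moreover have "finite (SIGMA x:X1. S x)" using fX1 fin(3) by (auto simp: S_def)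
  moreover have "finite F0" "finite F1" using fF by (auto simp: F0_def F1_def intro: finite_subset[of _ F])
  ultimately have "card F \<le> card (F0 \<union> (SIGMA x:X1. S x) \<union> F1)" by (intro card_mono) auto
  also have "\<dots> \<le> card F0 + card (SIGMA x:X1. S x) + card F1"
    using card_Un_le[of F0 "SIGMA x:X1. S x"] card_Un_le[of "F0 \<union> (SIGMA x:X1. S x)" F1] by linarith
  also have "\<dots> \<le> (zarankiewicz n n H2 L2 R2 + k2 * n) + k2 * n
      + 2 ^ (k2 + 2) * (zarankiewicz n n H1 L1 R1 + k1 * n)"
    using c0 c2 W(2) c3 unfolding F3_def[symmetric]
    by (meson add_mono mult_le_mono2 order_trans)
  finally show "card (edges G) \<le> 4 * ((zarankiewicz n n H2 L2 R2 + k2 * n) + k2 * n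
      + 2 ^ (k2 + 2) * (zarankiewicz n n H1 L1 R1 + k1 * n))"
    using order_trans[OF le[folded F_def] mult_le_mono2] by blast
qed

lemma ex_glue_bound:
  assumes H: "simple_graph H1" "simple_graph H2" "bipartition H1 L1 R1" "bipartition H2 L2 R2"
    and uv: "u \<in> L1" "v \<in> L2"
  obtains K where "\<And>n. ex n (glue H1 u H2 v) \<le>
    K * (zarankiewicz n n H1 L1 R1 + zarankiewicz n n H2 L2 R2 + n)"
proof -
  define k1 k2 c :: nat where "k1 = card (verts H1)" and "k2 = card (verts H2)" and "c = 2 ^ (k2 + 2)"
  \<comment> \<open>The constant is the sum of all coefficients in the expanded bound, and it does
    not depend on \<open>n\<close>.\<close>
  show thesis
  proof (rule that[of "4 + 8 * k2 + 4 * c + 4 * c * k1"])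
    fix n
    show "ex n (glue H1 u H2 v) \<le> (4 + 8 * k2 + 4 * c + 4 * c * k1) *
      (zarankiewicz n n H1 L1 R1 + zarankiewicz n n H2 L2 R2 + n)"
      using ex_glue_le[OF assms, of n] unfolding k1_def[symmetric] k2_def[symmetric] c_def[symmetric]
      by (rule order_trans) (simp add: algebra_simps)
  qed
qed

subsection \<open>Disjoint unions and connected graphs\<close>

lemma bipartition_restrict:
  assumes "simple_graph H" "bipartition H L R" "S \<subseteq> verts H"
  shows "simple_graph (Graph S {e \<in> edges H. e \<subseteq> S})"
    "bipartition (Graph S {e \<in> edges H. e \<subseteq> S}) (L \<inter> S) (R \<inter> S)"
    "embedding id (Graph S {e \<in> edges H. e \<subseteq> S}) H"
proof -
  show "simple_graph (Graph S {e \<in> edges H. e \<subseteq> S})"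
    using assms(1) finite_subset[OF assms(3)] by (auto simp: simple_graph_def)
  have "\<exists>x\<in>L \<inter> S. \<exists>y\<in>R \<inter> S. e = {x, y}" if "e \<in> edges H" "e \<subseteq> S" for e
  proof -
    from assms(2) that(1) obtain x y where "x \<in> L" "y \<in> R" "e = {x, y}"
      by (auto simp: bipartition_def)
    then show ?thesis using that(2) by auto
  qed
  then show "bipartition (Graph S {e \<in> edges H. e \<subseteq> S}) (L \<inter> S) (R \<inter> S)"
    using assms(2,3) by (auto simp: bipartition_def)
  show "embedding id (Graph S {e \<in> edges H. e \<subseteq> S}) H"
    using assms(3) by (auto simp: embedding_def)
qed

text \<open>Either there is no sided copy of \<open>H1\<close>, or one is fixed and its vertex set
  \<open>T\<close> deleted. A sided copy of \<open>H2\<close> in the rest would complete it to one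
  of \<open>H\<close>. The pairs meeting \<open>T\<close> cost
  \<open>2 * card (verts H) * n\<close>, the smaller sides another
  \<open>card (verts H) * n\<close>.\<close>

lemma zarankiewicz_disjoint_union:
  assumes H: "simple_graph H" "bipartition H L R" and S: "S \<subseteq> verts H"
    "\<And>e. e \<in> edges H \<Longrightarrow> e \<subseteq> S \<or> e \<inter> S = {}"
  defines "H1 \<equiv> Graph S {e \<in> edges H. e \<subseteq> S}"
    and "H2 \<equiv> Graph (verts H - S) {e \<in> edges H. e \<subseteq> verts H - S}"
  shows "zarankiewicz n n H L R \<le> zarankiewicz n n H1 (L \<inter> S) (R \<inter> S)
    + zarankiewicz n n H2 (L \<inter> (verts H - S)) (R \<inter> (verts H - S)) + 3 * card (verts H) * n"
proof (rule zarankiewicz_le[OF H])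
  let ?X = "left_part n" and ?Y = "right_part n" and ?S' = "verts H - S"
  fix F assume F: "F \<subseteq> ?X \<times> ?Y" "sided_free H L R ?X ?Y F"
  note H1 = bipartition_restrict[OF H S(1), folded H1_def]
  note H2 = bipartition_restrict[OF H Diff_subset[of "verts H" S], folded H2_def]
  have fin: "finite (verts H)" using H by (simp add: simple_graph_def)
  show "card F \<le> zarankiewicz n n H1 (L \<inter> S) (R \<inter> S)
    + zarankiewicz n n H2 (L \<inter> ?S') (R \<inter> ?S') + 3 * card (verts H) * n"
  proof (cases "sided_free H1 (L \<inter> S) (R \<inter> S) ?X ?Y F")
    case True
    then show ?thesis using card_le_zarankiewicz[OF H1(1,2) F(1)] by linarith
  next
    case False
    then obtain f where f: "sided_embedding f H1 (L \<inter> S) (R \<inter> S) ?X ?Y F"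
      by (auto simp: sided_free_def)
    define T where "T = f ` S"
    have fT: "finite T" "card T \<le> card (verts H)"
      unfolding T_def using finite_subset[OF S(1) fin] card_image_le[of S f] card_mono[OF fin S(1)]
      by auto
    let ?F = "F \<inter> ((?X - T) \<times> (?Y - T))"
    have "sided_free H2 (L \<inter> ?S') (R \<inter> ?S') (?X - T) (?Y - T) ?F"
      unfolding sided_free_def
    proof
      assume "\<exists>g. sided_embedding g H2 (L \<inter> ?S') (R \<inter> ?S') (?X - T) (?Y - T) ?F"
      then obtain g where g: "sided_embedding g H2 (L \<inter> ?S') (R \<inter> ?S') (?X - T) (?Y - T) ?F" by blast
      let ?h = "\<lambda>a. if a \<in> S then f a else g a"
      have LR: "L \<inter> R = {}" "L \<union> R = verts H" using H(2) by (auto simp: bipartition_def)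
      then have LRV: "L \<subseteq> verts H" "R \<subseteq> verts H" by auto
      have fi: "inj_on f S" and gi: "inj_on g ?S'"
        using f g by (auto simp: sided_embedding_def H1_def H2_def)
      have "g a \<notin> T" if "a \<in> ?S'" for a
        using that g LR(2) unfolding sided_embedding_def by blast
      then have "g a \<noteq> f b" if "a \<in> ?S'" "b \<in> S" for a b using that by (auto simp: T_def)
      then have "inj_on ?h (verts H)" using fi gi unfolding inj_on_def by (metis DiffI)
      moreover have "?h ` L \<subseteq> ?X" "?h ` R \<subseteq> ?Y"
        using f g subsetD[OF LRV(1)] subsetD[OF LRV(2)]
        by (auto simp: sided_embedding_def image_subset_iff)
      moreover have "(?h a, ?h b) \<in> F" if ab: "a \<in> L" "b \<in> R" "{a, b} \<in> edges H" for a b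
      proof (cases "a \<in> S")
        case True
        then have "{a, b} \<subseteq> S" using S(2)[OF ab(3)] by auto
        moreover from this have "{a, b} \<in> edges H1" using ab(3) by (simp add: H1_def)
        ultimately show ?thesis using f ab by (auto simp: sided_embedding_def)
      next
        case False
        then have sub: "{a, b} \<subseteq> ?S'" using S(2)[OF ab(3)] ab LR(2) by auto
        then have "{a, b} \<in> edges H2" using ab(3) by (simp add: H2_def)
        then show ?thesis using g ab sub by (auto simp: sided_embedding_def)
      qed
      ultimately have "sided_embedding ?h H L R ?X ?Y F" by (simp add: sided_embedding_def)
      then show False using F(2) by (auto simp: sided_free_def)
    qed
    moreover have "card (?X - T) \<le> n" "card (?Y - T) \<le> n"
      using card_mono[of ?X "?X - T"] card_mono[of ?Y "?Y - T"] by (auto simp: left_right_part)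
    moreover have "(?X - T) \<inter> (?Y - T) = {}" using left_right_part(1)[of n n] by blast
    ultimately have "card ?F \<le> zarankiewicz n n H2 (L \<inter> ?S') (R \<inter> ?S') + card (verts H2) * n"
      by (intro card_le_zarankiewicz_add[OF H2(1,2)]) (auto simp: left_right_part)
    moreover have "card (verts H2) * n \<le> card (verts H) * n"
      unfolding H2_def using card_mono[OF fin, of ?S'] by simp
    moreover have "card F \<le> card ?F + 2 * card (verts H) * n"
    proof -
      have "F \<subseteq> ?F \<union> (T \<times> ?Y \<union> ?X \<times> T)" using F(1) by auto
      then have "card F \<le> card (?F \<union> (T \<times> ?Y \<union> ?X \<times> T))"
        using F(1) fT(1) finite_subset[OF F(1)] by (intro card_mono) (auto simp: left_right_part)
      also have "\<dots> \<le> card ?F + (card (T \<times> ?Y) + card (?X \<times> T))"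
        using card_Un_le[of ?F "T \<times> ?Y \<union> ?X \<times> T"] card_Un_le[of "T \<times> ?Y" "?X \<times> T"] by linarith
      also have "\<dots> = card ?F + 2 * card T * n"
        by (simp add: card_cartesian_product left_right_part)
      also have "\<dots> \<le> card ?F + 2 * card (verts H) * n" using fT(2) by simp
      finally show ?thesis .
    qed
    ultimately show ?thesis by linarith
  qed
qed

text \<open>A copy of a connected \<open>H\<close> is embedded either as \<open>(L, R)\<close> or as \<open>(R, L)\<close>; gluing at vertices of
  opposite sides forces the two copies to be embedded in opposite ways.\<close>

lemma zarankiewicz_le_ex_glue:
  assumes H: "simple_graph H" "bipartition H L R"
    and connected: "\<And>S. S \<subseteq> verts H \<Longrightarrow> (\<And>e. e \<in> edges H \<Longrightarrow> e \<subseteq> S \<or> e \<inter> S = {})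
      \<Longrightarrow> S = {} \<or> S = verts H"
    and uv: "u \<in> L" "v \<in> R"
  shows "zarankiewicz n n H L R \<le> ex (2 * n) (glue H u H v)"
proof (rule zarankiewicz_le[OF H])
  let ?X = "left_part n" and ?Y = "right_part n"
  fix F assume F: "F \<subseteq> ?X \<times> ?Y" "sided_free H L R ?X ?Y F"
  let ?G = "bip_graph ?X ?Y F"
  have LR: "L \<inter> R = {}" "L \<union> R = verts H" using H(2) by (auto simp: bipartition_def)
  have dis: "?X \<inter> ?Y = {}" by (rule left_right_part)
  have rev: "f ` L \<subseteq> ?Y \<and> f ` R \<subseteq> ?X" if f: "embedding f H ?G" for f
  proof -
    have im: "f a \<in> ?X \<union> ?Y" if "a \<in> verts H" for a
      using f that by (auto simp: embedding_def bip_graph_def)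
    \<comment> \<open>The vertices that keep their side. Adjacent vertices keep or change sides
      together, so connectedness leaves only the two extreme cases.\<close>
    define S where "S = {a \<in> verts H. a \<in> L \<longleftrightarrow> f a \<in> ?X}"
    have "e \<subseteq> S \<or> e \<inter> S = {}" if e: "e \<in> edges H" for e
    proof -
      from e H(2) obtain a b where ab: "a \<in> L" "b \<in> R" "e = {a, b}" by (auto simp: bipartition_def)
      have "f ` e \<in> edges ?G" using f e by (simp add: embedding_def)
      then obtain x y where xy: "(x, y) \<in> F" "{f a, f b} = {x, y}"
        using ab(3) by (auto simp: bip_graph_def)
      then have "x \<in> ?X" "y \<in> ?Y" using F(1) by auto
      then have "f a \<in> ?X \<longleftrightarrow> f b \<notin> ?X" using xy(2) dis by (auto simp: doubleton_eq_iff)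
      then show ?thesis using ab LR by (auto simp: S_def)
    qed
    then consider "S = {}" | "S = verts H" using connected[of S] by (auto simp: S_def)
    then show ?thesis
    proof cases
      case 1
      then show ?thesis using LR im by (auto simp: S_def)
    next
      case 2
      then have "f ` L \<subseteq> ?X" "f ` R \<subseteq> ?Y" using LR im by (auto simp: S_def)
      then have "sided_embedding f H L R ?X ?Y F"
        using f sided_embedding_iff[OF H(2) dis F(1)] by blast
      then show ?thesis using F(2) by (auto simp: sided_free_def)
    qed
  qed
  have "\<not> contains_copy ?G (glue H u H v)"
  proof
    assume "contains_copy ?G (glue H u H v)"
    then obtain f where f: "embedding f (glue H u H v) ?G"
      using contains_copy_iff[OF simple_glue[OF H(1) H(1)]] by blast
    \<comment> \<open>Both copies of \<open>H\<close> inside the glued graph are reversed; since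
      \<open>u\<close> and \<open>v\<close> have opposite sides, the shared vertex would lie in both
      parts.\<close>
    have "(f \<circ> Inl) u \<in> ?Y" using rev[OF embedding_comp[OF embedding_glue_left f]] uv by blast
    moreover have "(f \<circ> (identify u v \<circ> Inr)) v \<in> ?X"
      using rev[OF embedding_comp[OF embedding_glue_right f]] uv by blast
    ultimately show False using dis by (auto simp: identify_def)
  qed
  then show "card F \<le> ex (2 * n) (glue H u H v)"
    using card_edges_le_ex[OF simple_glue[OF H(1) H(1)] simple_bip_graph[OF dis F(1)]]
    by (simp add: left_right_part card_edges_bip_graph[OF dis F(1)] card_verts_bip_graph mult_2)
qed

subsection \<open>Orders of magnitude\<close>

text \<open>The real constant is rounded up, so that all further estimates can be made in the
  naturals.\<close>

lemma bigtheta_natD: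
  fixes f g :: "nat \<Rightarrow> nat"
  assumes "(\<lambda>n. real (f n)) \<in> \<Theta>(\<lambda>n. real (g n))"
  obtains K N where "\<And>n. n \<ge> N \<Longrightarrow> f n \<le> K * g n"
proof -
  have "(\<lambda>n. real (f n)) \<in> O(\<lambda>n. real (g n))" using assms by (rule bigthetaD1)
  then obtain c where "eventually (\<lambda>n. norm (real (f n)) \<le> c * norm (real (g n))) at_top"
    by (auto simp: bigo_def)
  then obtain N where N: "\<And>n. n \<ge> N \<Longrightarrow> real (f n) \<le> c * real (g n)"
    by (auto simp: eventually_at_top_linorder)
  show thesis
  proof (rule that[of N "nat \<lceil>c\<rceil>"])
    fix n assume "n \<ge> N"
    then have "real (f n) \<le> c * real (g n)" by (rule N)
    also have "\<dots> \<le> real (nat \<lceil>c\<rceil>) * real (g n)" by (intro mult_right_mono) linarith+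
    finally show "f n \<le> nat \<lceil>c\<rceil> * g n" by (simp only: of_nat_mult[symmetric] of_nat_le_iff)
  qed
qed

lemma bigtheta_natI:
  fixes f g :: "nat \<Rightarrow> nat"
  assumes "\<And>n. n \<ge> N \<Longrightarrow> f n \<le> K * g n" "\<And>n. n \<ge> N \<Longrightarrow> g n \<le> K' * f n"
  shows "(\<lambda>n. real (f n)) \<in> \<Theta>(\<lambda>n. real (g n))"
proof (rule bigthetaI)
  have "real (f n) \<le> real K * real (g n)" if "n \<ge> N" for n
    using assms(1)[OF that] by (simp only: of_nat_mult[symmetric] of_nat_le_iff)
  then show "(\<lambda>n. real (f n)) \<in> O(\<lambda>n. real (g n))"
    by (intro bigoI[where c = "real K"]) (auto simp: eventually_at_top_linorder)
  have "real (g n) \<le> real K' * real (f n)" if "n \<ge> N" for n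
    using assms(2)[OF that] by (simp only: of_nat_mult[symmetric] of_nat_le_iff)
  then show "(\<lambda>n. real (f n)) \<in> \<Omega>(\<lambda>n. real (g n))"
    unfolding bigomega_iff_bigo
    by (intro bigoI[where c = "real K'"]) (auto simp: eventually_at_top_linorder)
qed

text \<open>Induction on the number of vertices: a disconnected \<open>H\<close> is split, and a
  connected \<open>H\<close> with two edges is glued to itself at the two ends of an edge. The
  summand \<open>n\<close> carries the error of the splitting; pieces with at most one edge have no
  linear \<open>ex_bip\<close> to absorb it.\<close>

lemma zarankiewicz_linear_bound:
  fixes H :: "nat graph"
  assumes glue: "\<And>(H :: nat graph) u v. bipartite H \<Longrightarrow> u \<in> verts H \<Longrightarrow> v \<in> verts H \<Longrightarrow>
      card (edges H) \<noteq> 1 \<Longrightarrow> (\<lambda>n. real (ex n (glue H u H v))) \<in> \<Theta>(\<lambda>n. real (ex n H))"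
    and "simple_graph H" "bipartition H L R"
  shows "\<exists>K N. \<forall>n\<ge>N. zarankiewicz n n H L R \<le> K * (ex_bip n n H + n)"
  using assms(2,3)
proof (induction "card (verts H)" arbitrary: H L R rule: less_induct)
  case less
  note H = less.prems
  have fin: "finite (verts H)" using H by (simp add: simple_graph_def)
  \<comment> \<open>\<open>S\<close> stands for a union of components; the last case expresses
    connectedness by the absence of a proper nonempty one.\<close>
  consider "card (edges H) \<le> 1"
    | S where "S \<subseteq> verts H" "\<And>e. e \<in> edges H \<Longrightarrow> e \<subseteq> S \<or> e \<inter> S = {}" "S \<noteq> {}" "S \<noteq> verts H"
    | "card (edges H) \<ge> 2" "\<And>S. S \<subseteq> verts H \<Longrightarrow> (\<And>e. e \<in> edges H \<Longrightarrow> e \<subseteq> S \<or> e \<inter> S = {})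
      \<Longrightarrow> S = {} \<or> S = verts H"
    by (metis Suc_1 not_less_eq_eq One_nat_def)
  then show ?case
  proof cases
    case 1
    then show ?thesis
      using zarankiewicz_eq_0[OF H 1] by (intro exI[of _ 0] exI[of _ "card (verts H)"]) simp
  next
    case 2
    let ?H1 = "Graph S {e \<in> edges H. e \<subseteq> S}"
    let ?H2 = "Graph (verts H - S) {e \<in> edges H. e \<subseteq> verts H - S}"
    let ?z1 = "\<lambda>n. zarankiewicz n n ?H1 (L \<inter> S) (R \<inter> S)"
    let ?z2 = "\<lambda>n. zarankiewicz n n ?H2 (L \<inter> (verts H - S)) (R \<inter> (verts H - S))"
    note H1 = bipartition_restrict[OF H 2(1)]
    note H2 = bipartition_restrict[OF H Diff_subset[of "verts H" S]]
    have "card (verts ?H1) < card (verts H)" "card (verts ?H2) < card (verts H)"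
      using 2 fin by (auto intro!: psubset_card_mono)
    then obtain K1 N1 K2 N2 where
      K1: "\<And>n. n \<ge> N1 \<Longrightarrow> ?z1 n \<le> K1 * (ex_bip n n ?H1 + n)" and
      K2: "\<And>n. n \<ge> N2 \<Longrightarrow> ?z2 n \<le> K2 * (ex_bip n n ?H2 + n)"
      using less.hyps[OF _ H1(1,2)] less.hyps[OF _ H2(1,2)] by meson
    show ?thesis
    proof (intro exI allI impI)
      fix n assume n: "n \<ge> max N1 N2"
      have "?z1 n \<le> K1 * (ex_bip n n H + n)"
        by (rule order_trans[OF K1]) (use n ex_bip_mono[OF H1(1) H(1) H1(3)] in auto)
      moreover have "?z2 n \<le> K2 * (ex_bip n n H + n)"
        by (rule order_trans[OF K2]) (use n ex_bip_mono[OF H2(1) H(1) H2(3)] in auto)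
      moreover have "zarankiewicz n n H L R \<le> ?z1 n + ?z2 n + 3 * card (verts H) * n"
        by (rule zarankiewicz_disjoint_union[OF H 2(1,2)])
      moreover have "3 * card (verts H) * n \<le> 3 * card (verts H) * (ex_bip n n H + n)" by simp
      ultimately show "zarankiewicz n n H L R \<le> (K1 + K2 + 3 * card (verts H)) * (ex_bip n n H + n)"
        by (simp only: distrib_right)
    qed
  next
    case 3
    from 3(1) obtain e where "e \<in> edges H" by fastforce
    then obtain u v where uv: "u \<in> L" "v \<in> R" using H(2) by (auto simp: bipartition_def)
    then have "u \<in> verts H" "v \<in> verts H" "bipartite H"
      using H by (auto simp: bipartite_def bipartition_def)
    then have "(\<lambda>n. real (ex n (glue H u H v))) \<in> \<Theta>(\<lambda>n. real (ex n H))"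
      using glue 3(1) by simp
    then obtain K N where K: "\<And>n. n \<ge> N \<Longrightarrow> ex n (glue H u H v) \<le> K * ex n H"
      by (rule bigtheta_natD) blast
    show ?thesis
    proof (intro exI allI impI)
      \<comment> \<open>\<open>N\<close> serves the gluing bound at \<open>2 * n\<close>, the value
        2 the halving of \<open>2 * n\<close>, and \<open>card (verts H)\<close> the comparison of
        \<open>ex\<close> with \<open>ex_bip\<close>.\<close>
      fix n assume n: "n \<ge> max N (max 2 (card (verts H)))"
      have "zarankiewicz n n H L R \<le> ex (2 * n) (glue H u H v)"
        by (rule zarankiewicz_le_ex_glue[OF H 3(2) uv])
      also have "\<dots> \<le> K * ex (2 * n) H" using K n by simp
      also have "\<dots> \<le> K * (64 * ex n H)" using ex_double[OF H(1)] n by simp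
      also have "\<dots> \<le> K * (64 * (4 * ex_bip n n H))" using ex_le_ex_bip[OF H(1)] n by simp
      also have "\<dots> \<le> (256 * K) * (ex_bip n n H + n)" by simp
      finally show "zarankiewicz n n H L R \<le> (256 * K) * (ex_bip n n H + n)" .
    qed
  qed
qed

section \<open>The cycle of implications from A to B to C and back to A\<close>

theorem theorem1:
  defines "A \<equiv> (\<forall>(H1 :: nat graph) (H2 :: nat graph) u v.
      bipartite H1 \<longrightarrow> bipartite H2 \<longrightarrow> u \<in> verts H1 \<longrightarrow> v \<in> verts H2 \<longrightarrow>
      \<not> (card (edges H1) = 1 \<and> card (edges H2) = 1) \<longrightarrow>
      (\<lambda>n. real (ex n (glue H1 u H2 v))) \<in> \<Theta>(\<lambda>n. real (ex n H1 + ex n H2)))"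
  and "B \<equiv> (\<forall>(H :: nat graph) u v.
      bipartite H \<longrightarrow> u \<in> verts H \<longrightarrow> v \<in> verts H \<longrightarrow> card (edges H) \<noteq> 1 \<longrightarrow>
      (\<lambda>n. real (ex n (glue H u H v))) \<in> \<Theta>(\<lambda>n. real (ex n H)))"
  and "C \<equiv> (\<forall>(H :: nat graph) L R.
      simple_graph H \<longrightarrow> bipartition H L R \<longrightarrow>
      (\<lambda>n. real (zarankiewicz n n H L R)) \<in> \<Theta>(\<lambda>n. real (ex_bip n n H)))"
  shows "(A \<longleftrightarrow> B) \<and> (B \<longleftrightarrow> C)"
proof -
  have "B" if A
    unfolding B_def
  proof (intro allI impI)
    fix H :: "nat graph" and u v
    assume "bipartite H" "u \<in> verts H" "v \<in> verts H" "card (edges H) \<noteq> 1"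
    then have "(\<lambda>n. real (ex n (glue H u H v))) \<in> \<Theta>(\<lambda>n. real (ex n H + ex n H))"
      using that unfolding A_def by blast
    also have "(\<lambda>n. real (ex n H + ex n H)) = (\<lambda>n. 2 * real (ex n H))" by auto
    finally show "(\<lambda>n. real (ex n (glue H u H v))) \<in> \<Theta>(\<lambda>n. real (ex n H))" by simp
  qed
  moreover have "C" if B
    unfolding C_def
  proof (intro allI impI)
    fix H :: "nat graph" and L R
    assume H: "simple_graph H" "bipartition H L R"
    show "(\<lambda>n. real (zarankiewicz n n H L R)) \<in> \<Theta>(\<lambda>n. real (ex_bip n n H))"
    proof (cases "card (edges H) \<le> 1")
      case True
      \<comment> \<open>With at most one edge both quantities vanish eventually, so the constants 0
        are enough.\<close>
      have "zarankiewicz n n H L R = 0 \<and> ex_bip n n H = 0" if "n \<ge> card (verts H)" for n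
        using zarankiewicz_eq_0[OF H True that] ex_bip_le_zarankiewicz[OF H, of n n] by simp
      then show ?thesis
        by (intro bigtheta_natI[where N = "card (verts H)" and K = 0 and K' = 0]) auto
    next
      case False
      have "\<exists>K N. \<forall>n\<ge>N. zarankiewicz n n H L R \<le> K * (ex_bip n n H + n)"
        by (rule zarankiewicz_linear_bound[OF _ H]) (use that in \<open>simp add: B_def\<close>)
      then obtain K N where K: "\<And>n. n \<ge> N \<Longrightarrow> zarankiewicz n n H L R \<le> K * (ex_bip n n H + n)"
        by blast
      show ?thesis
      proof (rule bigtheta_natI)
        fix n assume "n \<ge> N"
        then have "zarankiewicz n n H L R \<le> K * (ex_bip n n H + n)" by (rule K)
        \<comment> \<open>\<open>H\<close> has at least two edges here, so the linear term is itself
          at most \<open>ex_bip n n H\<close>.\<close>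
        also have "\<dots> \<le> K * (ex_bip n n H + ex_bip n n H)"
          using le_ex_bip[OF H(1), of n] False by simp
        finally show "zarankiewicz n n H L R \<le> (2 * K) * ex_bip n n H"
          by (simp add: algebra_simps)
        show "ex_bip n n H \<le> 1 * zarankiewicz n n H L R"
          using ex_bip_le_zarankiewicz[OF H] by simp
      qed
    qed
  qed
  moreover have "A" if C
    unfolding A_def
  proof (intro allI impI)
    fix H1 H2 :: "nat graph" and u v
    assume bip: "bipartite H1" "bipartite H2" and uv: "u \<in> verts H1" "v \<in> verts H2"
      and ne: "\<not> (card (edges H1) = 1 \<and> card (edges H2) = 1)"
    have H: "simple_graph H1" "simple_graph H2" using bip by (auto simp: bipartite_def)
    let ?K = "glue H1 u H2 v"
    have lower: "ex n H1 + ex n H2 \<le> 2 * ex n ?K" for n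
      using ex_mono[OF H(1) simple_glue[OF H] embedding_glue_left]
        ex_mono[OF H(2) simple_glue[OF H] embedding_glue_right] by (metis add_mono mult_2)
    have "\<exists>K N. \<forall>n\<ge>N. ex n ?K \<le> K * (ex n H1 + ex n H2)"
    proof (cases "card (edges H1) \<ge> 2 \<or> card (edges H2) \<ge> 2")
      case False
      \<comment> \<open>This is where the excluded pair matters: with at most one edge in each graph
        and not one in both, the glued graph has at most one edge.\<close>
      then have "card (edges ?K) \<le> 1" using ne card_edges_glue_le[OF H, of u v] by linarith
      then show ?thesis
        using ex_eq_0[OF simple_glue[OF H]] by (intro exI[of _ 0] exI[of _ "card (verts ?K)"]) simp
    next
      case True
      \<comment> \<open>Exchanging the sides if necessary puts the root on the left, as the gluing
        bound requires of both graphs.\<close>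
      have side: "\<exists>L R. bipartition K L R \<and> x \<in> L" if K: "bipartite K" "x \<in> verts K"
        for K :: "nat graph" and x
      proof -
        obtain L R where "bipartition K L R" using K(1) by (auto simp: bipartite_def)
        moreover from this have "x \<in> L \<or> x \<in> R" using K(2) by (auto simp: bipartition_def)
        ultimately show ?thesis using bipartition_commute by blast
      qed
      obtain L1 R1 L2 R2 where
        LR: "bipartition H1 L1 R1" "u \<in> L1" "bipartition H2 L2 R2" "v \<in> L2"
        using side bip uv by meson
      let ?z1 = "\<lambda>n. zarankiewicz n n H1 L1 R1" and ?z2 = "\<lambda>n. zarankiewicz n n H2 L2 R2"
      obtain K where K: "\<And>n. ex n ?K \<le> K * (?z1 n + ?z2 n + n)"
        using ex_glue_bound[OF H LR(1,3,2,4)] by blast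
      have "(\<lambda>n. real (?z1 n)) \<in> \<Theta>(\<lambda>n. real (ex_bip n n H1))"
        using \<open>C\<close> H(1) LR(1) unfolding C_def by blast
      then obtain K1 N1 where K1: "\<And>n. n \<ge> N1 \<Longrightarrow> ?z1 n \<le> K1 * ex_bip n n H1"
        by (rule bigtheta_natD) blast
      have "(\<lambda>n. real (?z2 n)) \<in> \<Theta>(\<lambda>n. real (ex_bip n n H2))"
        using \<open>C\<close> H(2) LR(3) unfolding C_def by blast
      then obtain K2 N2 where K2: "\<And>n. n \<ge> N2 \<Longrightarrow> ?z2 n \<le> K2 * ex_bip n n H2"
        by (rule bigtheta_natD) blast
      show ?thesis
      proof (intro exI allI impI)
        fix n assume n: "n \<ge> max 2 (max N1 N2)"
        let ?s = "ex n H1 + ex n H2"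
        \<comment> \<open>The factor 64 is the price for passing from the \<open>2 * n\<close>
          vertices of the complete bipartite graph to \<open>n\<close> vertices.\<close>
        have b: "ex_bip n n H1 \<le> 64 * ?s" "ex_bip n n H2 \<le> 64 * ?s"
          using ex_bip_le_ex[OF H(1), of n] ex_bip_le_ex[OF H(2), of n]
            ex_double[OF H(1), of n] ex_double[OF H(2), of n] n by auto
        have "?z1 n \<le> K1 * (64 * ?s)" "?z2 n \<le> K2 * (64 * ?s)"
          using K1[of n] K2[of n] b n by (meson max.boundedE mult_le_mono2 order_trans)+
        \<comment> \<open>One of the two graphs has at least two edges, and its
          \<open>ex_bip\<close> is then at least \<open>n\<close>.\<close>
        moreover have "n \<le> 64 * ?s"
          using True le_ex_bip[OF H(1), of n] le_ex_bip[OF H(2), of n] b by linarith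
        ultimately have "?z1 n + ?z2 n + n \<le> (K1 + K2 + 1) * (64 * ?s)"
          by (simp add: distrib_right)
        then have "K * (?z1 n + ?z2 n + n) \<le> K * ((K1 + K2 + 1) * (64 * ?s))"
          by (rule mult_le_mono2)
        then show "ex n ?K \<le> (K * (K1 + K2 + 1) * 64) * ?s"
          unfolding mult.assoc by (rule order_trans[OF K])
      qed
    qed
    then obtain K N where "\<And>n. n \<ge> N \<Longrightarrow> ex n ?K \<le> K * (ex n H1 + ex n H2)" by blast
    then show "(\<lambda>n. real (ex n ?K)) \<in> \<Theta>(\<lambda>n. real (ex n H1 + ex n H2))"
      using lower by (rule bigtheta_natI)
  qed
  ultimately show ?thesis by blast
qed

end
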